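(* Suppose that (i) $M:=\sum_{t=0}^\infty\big(\sup_{i\in\mathcal S,u\in U}|f(t,i,u)|+\delta(t)\big)<\infty$; (ii) $$\Theta:=\sup_{t\in\mathbb N_0,\,i\in\mathcal S}\ \sup_{u_1,u_2\in U,\,u_1\ne u_2}\Big\{\frac{|f(t,i,u_1)-f(t,i,u_2)|}{|u_1-u_2|}+\frac{|p^{u_1}_i-p^{u_2}_i|}{|u_1-u_2|}\Big\}<\infty;$$ and (iii) $U$ satisfies the uniform cone condition. Then for every $\lambda>0$ there exists $y\in\mathbb R^d$ such that $\Psi_\lambda(y)=y$. Hence, $\Gamma_\lambda(y,\cdot)\in\Pi_r$ is a regular relaxed equilibrium for $J_\lambda$.
   Context: Setting (discrete time). $\mathbb N_0=\mathbb N\cup\{0\}$. Fix $\ell,d\in\mathbb N$; $U\subset\mathbb R^\ell$ is compact with Lebesgue measure $\mathrm{Leb}(U)>0$; $\mathcal S=\{1,\dots,d\}$. For each $u\in U$, $p^u=(p^u_{ij})_{i,j\in\mathcal S}$ is a stochastic matrix and $p^u_i\in\mathbb R^d$ is its $i$-th row. $\mathcal P(U)$ is the set of Borel probability measures on $U$, $\mathcal D(U)$ the set of probability density functions on $U$ (w.r.t. Lebesgue measure, identified when a.e. equal). A relaxed feedback control is a map $\pi:\mathcal S\to\mathcal P(U)$; $\Pi$ is the set of all of them. Under $\pi$, $X^\pi=(X^\pi_k)_{k\in\mathbb N_0}$ is the $\mathcal S$-valued Markov chain such that, given $X_t=i$, an action $u$ is sampled from $\pi(i)$ and $X_{t+1}=j$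 with probability $p^u_{ij}$ (so its transition probabilities are $\int_U p^u_{ij}\,\pi(i)(du)$). $\mathbb E_i$ is expectation given $X_0=i$. The reward is $f:[0,\infty)\times\mathcal S\times U\to\mathbb R$, and $f^\mu(t,i):=\int_U f(t,i,u)\mu(du)$ for $\mu\in\mathcal P(U)$. The discount function $\delta:[0,\infty)\to[0,1]$ is nonincreasing with $\delta(0)=1$. $|\cdot|$ is the Euclidean norm. For $\rho\in\mathcal D(U)$, $\mathcal H(\rho):=-\int_U\ln(\rho(u))\rho(u)\,du$. $\Pi_r$ is the set of regular relaxed feedback controls: those $\pi\in\Pi$ such that each $\pi(i)$ has a density in $\mathcal D(U)$ (identified with $\pi(i)$) with $\mathcal H(\pi(i))>-\infty$. For $\lambda>0$, $\pi\in\Pi_r$, $i\in\mathcal S$: $$J^\pi_\lambda(i):=\mathbb E_i\Big[\sum_{k=0}^\infty\big(f^{\pi(X^\pi_k)}(k,X^\pi_k)+\lambda\delta(k)\mathcal H(\pi(X^\pi_k))\big)\Big],$$ $$V^\pi_\lambda(i):=\mathbb E_i\Big[\sum_{k=0}^\infty\big(f^{\pi(X^\pi_k)}(1+k,X^\pi_k)+\lambda\delta(1+k)\mathcal H(\pi(X^\pi_k))\big)\Big],$$ with $V^\pi_\lambda=(V^\pi_\lambda(1),\dots,V^\pi_\lambda(d))\in\mathbb R^d$. For $\pi,\pi'$, $\pi'\otimes_1\pi$ means using $\pi'$ at time $0$ and $\pi$ at all times $\ge1$ (both for sampling actions and for the reward/entropy terms); $J_\lambda^{\pi'\otimes_1\pi}$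 is the corresponding value. $\pi\in\Pi_r$ is a regular relaxed equilibrium (for $J_\lambda$) if $J_\lambda^{\pi'\otimes_1\pi}(i)\le J_\lambda^\pi(i)$ for all $i\in\mathcal S$ and $\pi'\in\Pi_r$. $\Gamma_\lambda:\mathbb R^d\times\mathcal S\to\mathcal D(U)$ is $$\Gamma_\lambda(y,i)(u):=\frac{e^{\frac1\lambda(f(0,i,u)+p^u_i\cdot y)}}{\int_U e^{\frac1\lambda(f(0,i,v)+p^v_i\cdot y)}dv},$$ and $\Psi_\lambda:\mathbb R^d\to\mathbb R^d$ is $\Psi_\lambda(y):=V_\lambda^{\Gamma_\lambda(y,\cdot)}$. Uniform cone condition: if $\ell>1$, there are $\vartheta>0$ and $\iota\in(0,\pi/2]$ such that for every $u\in U$ there is a cone with vertex $u$ and angle $\iota$, $\mathrm{cone}(u,\iota)$, with $\mathrm{cone}(u,\iota)\cap B_\vartheta(u)\subseteq U$; if $\ell=1$, there is $\vartheta>0$ such that for every $u\in U$ either $[u-\vartheta,u]\subseteq U$ or $[u,u+\vartheta]\subseteq U$. Here a cone with vertex $u$ and angle $\iota$ is any rotation about $u$ of $u+\Delta_\iota$, where $\Delta_\iota=\{v\in\mathbb R^\ell: v_\ell\ge0,\ v_1^2+\dots+v_{\ell-1}^2\le\tan^2(\iota)v_\ell^2\}$ (the half-space $v_\ell\ge0$ if $\iota=\pi/2$), and $B_\vartheta(u)$ is the ball of radius $\vartheta$ about $u$. *)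

theory Defs
  imports "HOL-Probability.Probability"
begin

text \<open>
  The dimensions of the action space and of the state space are the cardinalities of the
  index types: actions live in \<open>real ^ 'l\<close> and the state space is the finite type \<open>'s\<close>, so that
  \<open>real ^ 's\<close> is the space of vectors indexed by states.  The type \<open>'l\<close> is
  linearly ordered only to single out the last coordinate in the cone condition.
  The transition matrix under the action \<open>u\<close> is \<open>p u\<close>, with \<open>i\<close>-th row \<open>p u $ i\<close>.
\<close>

definition stochastic_matrix :: "real ^ 's ^ 's \<Rightarrow> bool" where
  "stochastic_matrix P \<longleftrightarrow> (\<forall>i j. 0 \<le> P $ i $ j) \<and> (\<forall>i. (\<Sum>j\<in>UNIV. P $ i $ j) = 1)"

subsection \<open>Uniform cone condition\<close>

definition std_cone :: "real \<Rightarrow> (real ^ 'l::{finite,linorder}) set" where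
  "std_cone \<iota> =
     {v. 0 \<le> v $ Max UNIV \<and>
         (\<iota> \<noteq> pi / 2 \<longrightarrow>
           (\<Sum>j\<in>UNIV - {Max UNIV}. (v $ j)\<^sup>2) \<le> (tan \<iota>)\<^sup>2 * (v $ Max UNIV)\<^sup>2)}"

definition is_cone_at ::
  "real ^ 'l::{finite,linorder} \<Rightarrow> real \<Rightarrow> (real ^ 'l::{finite,linorder}) set \<Rightarrow> bool" where
  "is_cone_at u \<iota> C \<longleftrightarrow> (\<exists>R. rotation_matrix R \<and> C = (\<lambda>v. u + R *v v) ` std_cone \<iota>)"

text \<open>In dimension one, \<open>vec \<theta>\<close> is the number \<open>\<theta>\<close> viewed as an element of \<open>real ^ 'l\<close>.\<close>

definition uniform_cone_condition :: "(real ^ 'l::{finite,linorder}) set \<Rightarrow> bool" where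
  "uniform_cone_condition U \<longleftrightarrow>
     (if CARD('l) > 1
      then \<exists>\<theta>>0. \<exists>\<iota>. 0 < \<iota> \<and> \<iota> \<le> pi / 2 \<and>
             (\<forall>u\<in>U. \<exists>C. is_cone_at u \<iota> C \<and> C \<inter> ball u \<theta> \<subseteq> U)
      else \<exists>\<theta>>0. \<forall>u\<in>U. cbox (u - vec \<theta>) u \<subseteq> U \<or> cbox u (u + vec \<theta>) \<subseteq> U)"

subsection \<open>Controls, densities and entropy\<close>

abbreviation leb_on :: "(real ^ 'l) set \<Rightarrow> (real ^ 'l) measure" where
  "leb_on U \<equiv> restrict_space lborel U"

definition densities :: "(real ^ 'l) set \<Rightarrow> (real ^ 'l \<Rightarrow> real) set" where
  "densities U = {\<rho>. \<rho> \<in> borel_measurable (leb_on U) \<and> (\<forall>u\<in>U. 0 \<le> \<rho> u) \<and>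
                     (\<integral>\<^sup>+u. ennreal (\<rho> u) \<partial>leb_on U) = 1}"

definition law_of :: "(real ^ 'l) set \<Rightarrow> (real ^ 'l \<Rightarrow> real) \<Rightarrow> (real ^ 'l) measure" where
  "law_of U \<rho> = density (leb_on U) (\<lambda>u. ennreal (\<rho> u))"

definition relaxed_controls :: "(real ^ 'l) set \<Rightarrow> ('s \<Rightarrow> (real ^ 'l) measure) set" where
  "relaxed_controls U = {\<pi>. \<forall>i. \<pi> i \<in> space (prob_algebra (restrict_space borel U))}"

text \<open>
  The entropy takes extended real values: it is the integral of the positive part minus the
  integral of the negative part of \<open>- ln \<rho> * \<rho>\<close>.  When \<open>U\<close> has finite
  Lebesgue measure the first integral is finite, as \<open>- ln x * x \<le> exp (-1)\<close>.
  Note that \<open>ln 0 * 0 = 0\<close>, the usual convention.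
\<close>

definition dens_entropy :: "(real ^ 'l) set \<Rightarrow> (real ^ 'l \<Rightarrow> real) \<Rightarrow> ereal" where
  "dens_entropy U \<rho> =
     enn2ereal (\<integral>\<^sup>+u. ennreal (- (ln (\<rho> u) * \<rho> u)) \<partial>leb_on U)
     - enn2ereal (\<integral>\<^sup>+u. ennreal (ln (\<rho> u) * \<rho> u) \<partial>leb_on U)"

definition regular_controls :: "(real ^ 'l) set \<Rightarrow> ('s \<Rightarrow> (real ^ 'l) measure) set" where
  "regular_controls U =
     {\<pi> \<in> relaxed_controls U.
        \<forall>i. \<exists>\<rho>\<in>densities U. \<pi> i = law_of U \<rho> \<and> dens_entropy U \<rho> > -\<infinity>}"

text \<open>
  Entropy of an absolutely continuous law, through its (almost everywhere unique) density; for
  regular controls the extended real value is finite.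
\<close>

definition entropy_of :: "(real ^ 'l) set \<Rightarrow> (real ^ 'l) measure \<Rightarrow> real" where
  "entropy_of U \<mu> = real_of_ereal (dens_entropy U (\<lambda>u. enn2real (RN_deriv (leb_on U) \<mu> u)))"

subsection \<open>The controlled Markov chain\<close>

text \<open>
  A policy \<open>\<sigma>\<close> assigns a relaxed control to every time.
  Under \<open>\<sigma>\<close> and started at \<open>i\<close>, the state process is the coordinate
  process on \<open>nat \<Rightarrow> 's\<close> under \<open>path_law p \<sigma> i\<close>, the Ionescu-Tulcea
  measure with initial law concentrated at \<open>i\<close> and transition probability from state
  \<open>j\<close> at time \<open>t\<close> to state \<open>k\<close> equal to the integral of
  \<open>p u $ j $ k\<close> with respect to \<open>\<sigma> t j\<close>.
\<close>

definition transition_law ::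
  "(real ^ 'l \<Rightarrow> real ^ 's ^ 's) \<Rightarrow> ('s \<Rightarrow> (real ^ 'l) measure) \<Rightarrow> 's \<Rightarrow> 's measure" where
  "transition_law p \<pi> j = point_measure UNIV (\<lambda>k. ennreal (\<integral>u. p u $ j $ k \<partial>\<pi> j))"

definition path_kernel ::
  "(real ^ 'l \<Rightarrow> real ^ 's ^ 's) \<Rightarrow> (nat \<Rightarrow> 's \<Rightarrow> (real ^ 'l) measure) \<Rightarrow> 's
     \<Rightarrow> nat \<Rightarrow> (nat \<Rightarrow> 's) \<Rightarrow> 's measure" where
  "path_kernel p \<sigma> i n \<omega> =
     (case n of 0 \<Rightarrow> return (count_space UNIV) i
      | Suc t \<Rightarrow> transition_law p (\<sigma> t) (\<omega> t))"

definition path_law ::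
  "(real ^ 'l \<Rightarrow> real ^ 's ^ 's) \<Rightarrow> (nat \<Rightarrow> 's \<Rightarrow> (real ^ 'l) measure) \<Rightarrow> 's
     \<Rightarrow> (nat \<Rightarrow> 's) measure" where
  "path_law p \<sigma> i =
     projective_family.lim UNIV
       (Ionescu_Tulcea.CI (path_kernel p \<sigma> i) (\<lambda>_. count_space UNIV)) (\<lambda>_. count_space UNIV)"

subsection \<open>Value functions and equilibria\<close>

definition avg_reward ::
  "(real \<Rightarrow> 's \<Rightarrow> real ^ 'l \<Rightarrow> real) \<Rightarrow> (real ^ 'l) measure \<Rightarrow> real \<Rightarrow> 's \<Rightarrow> real" where
  "avg_reward f \<mu> t i = (\<integral>u. f t i u \<partial>\<mu>)"

text \<open>
  \<open>shifted_value U p f \<delta> lam s \<sigma> i\<close> is the expected total entropy-regularized reward when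
  rewards and discounts are evaluated with the time shift \<open>s\<close>.
\<close>

definition shifted_value ::
  "(real ^ 'l) set \<Rightarrow> (real ^ 'l \<Rightarrow> real ^ 's ^ 's) \<Rightarrow> (real \<Rightarrow> 's \<Rightarrow> real ^ 'l \<Rightarrow> real)
     \<Rightarrow> (real \<Rightarrow> real) \<Rightarrow> real \<Rightarrow> nat \<Rightarrow> (nat \<Rightarrow> 's \<Rightarrow> (real ^ 'l) measure) \<Rightarrow> 's \<Rightarrow> real" where
  "shifted_value U p f \<delta> lam s \<sigma> i =
     (\<integral>\<omega>. (\<Sum>k. avg_reward f (\<sigma> k (\<omega> k)) (real (s + k)) (\<omega> k)
                 + lam * \<delta> (real (s + k)) * entropy_of U (\<sigma> k (\<omega> k)))
        \<partial>path_law p \<sigma> i)"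

definition J_policy ::
  "(real ^ 'l) set \<Rightarrow> (real ^ 'l \<Rightarrow> real ^ 's ^ 's) \<Rightarrow> (real \<Rightarrow> 's \<Rightarrow> real ^ 'l \<Rightarrow> real)
     \<Rightarrow> (real \<Rightarrow> real) \<Rightarrow> real \<Rightarrow> (nat \<Rightarrow> 's \<Rightarrow> (real ^ 'l) measure) \<Rightarrow> 's \<Rightarrow> real" where
  "J_policy U p f \<delta> lam = shifted_value U p f \<delta> lam 0"

definition V_control ::
  "(real ^ 'l) set \<Rightarrow> (real ^ 'l \<Rightarrow> real ^ 's ^ 's) \<Rightarrow> (real \<Rightarrow> 's \<Rightarrow> real ^ 'l \<Rightarrow> real)
     \<Rightarrow> (real \<Rightarrow> real) \<Rightarrow> real \<Rightarrow> ('s \<Rightarrow> (real ^ 'l) measure) \<Rightarrow> real ^ 's" where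
  "V_control U p f \<delta> lam \<pi> = (\<chi> i. shifted_value U p f \<delta> lam 1 (\<lambda>_. \<pi>) i)"

definition concat1 :: "'c \<Rightarrow> 'c \<Rightarrow> nat \<Rightarrow> 'c" where
  "concat1 \<pi>' \<pi> = (\<lambda>k. if k = 0 then \<pi>' else \<pi>)"

definition regular_equilibrium ::
  "(real ^ 'l) set \<Rightarrow> (real ^ 'l \<Rightarrow> real ^ 's ^ 's) \<Rightarrow> (real \<Rightarrow> 's \<Rightarrow> real ^ 'l \<Rightarrow> real)
     \<Rightarrow> (real \<Rightarrow> real) \<Rightarrow> real \<Rightarrow> ('s \<Rightarrow> (real ^ 'l) measure) \<Rightarrow> bool" where
  "regular_equilibrium U p f \<delta> lam \<pi> \<longleftrightarrow>
     \<pi> \<in> regular_controls U \<and>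
     (\<forall>i. \<forall>\<pi>'\<in>regular_controls U.
        J_policy U p f \<delta> lam (concat1 \<pi>' \<pi>) i \<le> J_policy U p f \<delta> lam (\<lambda>_. \<pi>) i)"

definition Gamma_density ::
  "(real ^ 'l) set \<Rightarrow> (real ^ 'l \<Rightarrow> real ^ 's ^ 's) \<Rightarrow> (real \<Rightarrow> 's \<Rightarrow> real ^ 'l \<Rightarrow> real)
     \<Rightarrow> real \<Rightarrow> real ^ 's \<Rightarrow> 's \<Rightarrow> real ^ 'l \<Rightarrow> real" where
  "Gamma_density U p f lam y i u =
     exp (1 / lam * (f 0 i u + (p u $ i) \<bullet> y))
     / (\<integral>v. exp (1 / lam * (f 0 i v + (p v $ i) \<bullet> y)) \<partial>leb_on U)"

definition Gamma_control ::
  "(real ^ 'l) set \<Rightarrow> (real ^ 'l \<Rightarrow> real ^ 's ^ 's) \<Rightarrow> (real \<Rightarrow> 's \<Rightarrow> real ^ 'l \<Rightarrow> real)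
     \<Rightarrow> real \<Rightarrow> real ^ 's \<Rightarrow> 's \<Rightarrow> (real ^ 'l) measure" where
  "Gamma_control U p f lam y i = law_of U (Gamma_density U p f lam y i)"

definition Psi ::
  "(real ^ 'l) set \<Rightarrow> (real ^ 'l \<Rightarrow> real ^ 's ^ 's) \<Rightarrow> (real \<Rightarrow> 's \<Rightarrow> real ^ 'l \<Rightarrow> real)
     \<Rightarrow> (real \<Rightarrow> real) \<Rightarrow> real \<Rightarrow> real ^ 's \<Rightarrow> real ^ 's" where
  "Psi U p f \<delta> lam y = V_control U p f \<delta> lam (Gamma_control U p f lam y)"

end

theory Submission
  imports Defs
begin

text \<open>
  Since the density \<open>Gamma_density U p f lam y i\<close> is the Gibbs density of the gain
  \<open>f 0 i u + p u $ i \<bullet> y\<close> at temperature \<open>lam\<close>, Gibbs' inequality says that it maximises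
  expected gain plus \<open>lam\<close> times entropy.  Deviating at time \<open>0\<close> only and then following
  \<open>Gamma_control U p f lam y\<close> yields exactly this objective when \<open>y\<close> is the continuation value,
  that is when \<open>Psi U p f \<delta> lam y = y\<close>; hence fixed points give equilibria.

  A fixed point comes from Brouwer's theorem on a large ball.  The gain is Lipschitz in \<open>u\<close> with
  a constant linear in \<open>norm y\<close>, and the cone condition puts into \<open>U\<close>, near each of its points
  and at each small scale, a ball of comparable radius.  So the Gibbs density is at most polynomial
  in \<open>norm y\<close>, its entropy grows only logarithmically, and \<open>Psi\<close> maps large balls
  into themselves.
\<close>

section \<open>Marginals of the controlled chain\<close>

text \<open>The law at time \<open>n\<close> of a time-inhomogeneous chain started at
  \<open>i\<close>, where \<open>q n j k\<close> is the probability of moving from \<open>j\<close>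
  to \<open>k\<close> at step \<open>n\<close>. Every value is a polynomial in finitely many entries
  of \<open>q\<close>, so it inherits continuity in any parameter on which \<open>q\<close> depends
  continuously.\<close>

primrec marginal :: "(nat \<Rightarrow> 's \<Rightarrow> 's \<Rightarrow> real) \<Rightarrow> 's \<Rightarrow> nat \<Rightarrow> 's::finite \<Rightarrow> real" where
  "marginal q i 0 = (\<lambda>k. of_bool (k = i))"
| "marginal q i (Suc n) = (\<lambda>k. \<Sum>j\<in>UNIV. marginal q i n j * q n j k)"

lemma marginal_nonneg:
  assumes "\<And>n j k. 0 \<le> q n j k"
  shows "0 \<le> marginal q i n k"
  by (induction n arbitrary: k) (auto intro!: sum_nonneg mult_nonneg_nonneg assms)

lemma sum_marginal:
  assumes "\<And>n j. (\<Sum>k\<in>UNIV. q n j k) = 1"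
  shows "(\<Sum>k\<in>UNIV. marginal q i n k) = 1"
proof (induction n)
  case (Suc n)
  have "(\<Sum>k\<in>UNIV. marginal q i (Suc n) k) = (\<Sum>j\<in>UNIV. \<Sum>k\<in>UNIV. marginal q i n j * q n j k)"
    by simp (rule sum.swap)
  then show ?case
    using Suc by (simp add: assms flip: sum_distrib_left)
qed (simp add: of_bool_def)

text \<open>The defining recursion splits off the last step; conditioning on the first step instead
  gives a mixture of chains whose kernels are shifted by one. One-step deviations are analysed in
  this form. The induction only interchanges two finite sums.\<close>

lemma marginal_first_step:
  "marginal q i (Suc n) k = (\<Sum>j\<in>UNIV. q 0 i j * marginal (\<lambda>t. q (Suc t)) j n k)"
proof (induction n arbitrary: k)
  case 0
  show ?case by (simp add: of_bool_def if_distrib[of "\<lambda>x. x * _"] if_distrib[of "\<lambda>x. _ * x"] sum.delta' cong: if_cong)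
next
  case (Suc n)
  have "marginal q i (Suc (Suc n)) k
      = (\<Sum>l\<in>UNIV. (\<Sum>j\<in>UNIV. q 0 i j * marginal (\<lambda>t. q (Suc t)) j n l) * q (Suc n) l k)"
    using Suc by (simp only: marginal.simps(2)[of q i "Suc n"])
  also have "\<dots> = (\<Sum>j\<in>UNIV. q 0 i j * marginal (\<lambda>t. q (Suc t)) j (Suc n) k)"
    by (simp add: sum_distrib_left sum_distrib_right mult.assoc) (rule sum.swap)
  finally show ?case .
qed

text \<open>Every reward depends on a single coordinate of the path, so the Ionescu-Tulcea measure
  matters only through its one-time marginals. Integrals of \<open>g (\<omega> n)\<close> are
  computed on the finite-horizon measures \<open>IT.C\<close> by induction on \<open>n\<close> and
  then carried over to the projective limit.\<close>

lemma path_law_marginals: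
  fixes p :: "real ^ 'l \<Rightarrow> real ^ 's::finite ^ 's" and \<sigma> :: "nat \<Rightarrow> 's \<Rightarrow> (real ^ 'l) measure"
  defines "q \<equiv> \<lambda>t j k. \<integral>u. p u $ j $ k \<partial>\<sigma> t j"
  assumes nonneg: "\<And>t j k. 0 \<le> q t j k" and sum_1: "\<And>t j. (\<Sum>k\<in>UNIV. q t j k) = 1"
  shows prob_space_path_law: "prob_space (path_law p \<sigma> i)" (is ?A)
    and sets_path_law: "sets (path_law p \<sigma> i) = sets (PiM UNIV (\<lambda>_. count_space UNIV))" (is ?B)
    and distr_path_law: "distr (path_law p \<sigma> i) (count_space UNIV) (\<lambda>\<omega>. \<omega> n)
           = point_measure UNIV (\<lambda>k. ennreal (marginal q i n k))" (is ?C)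
proof -
  let ?M = "\<lambda>_::nat. count_space (UNIV :: 's set)"
  have K_eq: "transition_law p (\<sigma> t) j = point_measure UNIV (\<lambda>k. ennreal (q t j k))" for t j
    by (simp add: transition_law_def q_def)
  have prob: "prob_space (transition_law p (\<sigma> t) j)" for t j
    unfolding K_eq
    by (intro prob_spaceI) (simp add: space_point_measure emeasure_point_measure_finite nonneg sum_1)
  have meas: "transition_law p (\<sigma> t) \<in> measurable (count_space UNIV) (subprob_algebra (count_space UNIV))" for t
    using prob[unfolded K_eq]
    by (auto simp: K_eq space_subprob_algebra prob_space_imp_subprob_space sets_point_measure)
  interpret IT: Ionescu_Tulcea "path_kernel p \<sigma> i" ?M
  proof (rule Ionescu_Tulcea.intro)
    fix n
    show "path_kernel p \<sigma> i n \<in> measurable (PiM {0..<n} ?M) (subprob_algebra (count_space UNIV))"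
    proof (cases n)
      case 0
      then show ?thesis
        by (simp add: path_kernel_def[abs_def] space_subprob_algebra prob_space_imp_subprob_space prob_space_return)
    next
      case (Suc t)
      have "(\<lambda>\<omega>. transition_law p (\<sigma> t) (\<omega> t))
          \<in> measurable (PiM {0..<Suc t} ?M) (subprob_algebra (count_space UNIV))"
        by (rule measurable_compose[OF measurable_component_singleton[of t "{0..<Suc t}" ?M] meas]) simp
      then show ?thesis
        unfolding path_kernel_def Suc by simp
    qed
    fix x :: "nat \<Rightarrow> 's"
    show "prob_space (path_kernel p \<sigma> i n x)"
      by (cases n) (simp_all add: path_kernel_def prob prob_space_return)
  qed
  \<comment> \<open>Kernel \<open>0\<close> produces the initial state, so coordinate
    \<open>n\<close> exists only after \<open>Suc n\<close> kernels have been applied to the empty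
    history, which is \<open>\<lambda>_. undefined\<close>.\<close>
  have C: "(\<integral>\<^sup>+\<omega>. g (\<omega> n) \<partial>IT.C 0 (Suc n) (\<lambda>_. undefined)) = (\<Sum>k\<in>UNIV. ennreal (marginal q i n k) * g k)"
    for n and g :: "'s \<Rightarrow> ennreal"
  proof (induction n arbitrary: g)
    case 0
    have m: "(\<lambda>\<omega>. g (\<omega> 0)) \<in> borel_measurable (PiM {0..<Suc 0} ?M)"
      by (rule measurable_compose[OF measurable_component_singleton]) auto
    have "(\<integral>\<^sup>+\<omega>. g (\<omega> 0) \<partial>IT.C 0 (Suc 0) (\<lambda>_. undefined)) = (\<integral>\<^sup>+\<omega>. g (\<omega> 0) \<partial>IT.eP 0 (\<lambda>_. undefined))"
      by (simp add: bind_return[OF IT.measurable_eP[of 0, simplified]] space_PiM)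
    also have "\<dots> = g i"
      by (subst IT.nn_integral_eP[OF _ m]) (simp_all add: space_PiM path_kernel_def nn_integral_return)
    finally show ?case
      by (simp add: of_bool_def if_distrib[of ennreal] if_distrib[of "\<lambda>x. x * _"] cong: if_cong)
  next
    case (Suc n)
    have m: "(\<lambda>\<omega>. g (\<omega> (Suc n))) \<in> borel_measurable (PiM {0..<Suc (Suc n)} ?M)"
      by (rule measurable_compose[OF measurable_component_singleton]) auto
    have sets_C: "sets (IT.C 0 (Suc n) (\<lambda>_. undefined)) = sets (PiM {0..<Suc n} ?M)"
      by (subst IT.sets_C) (auto simp: space_PiM)
    have sp: "space (IT.C 0 (Suc n) (\<lambda>_. undefined)) = space (PiM {0..<Suc n} ?M)"
      by (subst IT.space_C) (auto simp: space_PiM)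
    \<comment> \<open>Integrating out the newest coordinate leaves a function of
      \<open>\<omega> n\<close> alone; the induction hypothesis applies to it because
      \<open>g\<close> is arbitrary.\<close>
    have "(\<integral>\<^sup>+\<omega>. g (\<omega> (Suc n)) \<partial>IT.C 0 (Suc (Suc n)) (\<lambda>_. undefined))
        = (\<integral>\<^sup>+\<omega>. (\<integral>\<^sup>+\<omega>'. g (\<omega>' (Suc n)) \<partial>IT.eP (Suc n) \<omega>) \<partial>IT.C 0 (Suc n) (\<lambda>_. undefined))"
      unfolding IT.C.simps(2)[of 0 "Suc n"] add_0
    proof (rule nn_integral_bind[OF m])
      show "IT.eP (Suc n) \<in> measurable (IT.C 0 (Suc n) (\<lambda>_. undefined))
          (subprob_algebra (PiM {0..<Suc (Suc n)} ?M))"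
        using IT.measurable_eP[of "Suc n"] sets_C by (simp cong: measurable_cong_sets)
    qed
    also have "\<dots> = (\<integral>\<^sup>+\<omega>. (\<Sum>k\<in>UNIV. ennreal (q n (\<omega> n) k) * g k) \<partial>IT.C 0 (Suc n) (\<lambda>_. undefined))"
      by (intro nn_integral_cong)
         (simp add: sp IT.nn_integral_eP[OF _ m] path_kernel_def K_eq nn_integral_point_measure_finite del: IT.C.simps)
    also have "\<dots> = (\<Sum>j\<in>UNIV. ennreal (marginal q i n j) * (\<Sum>k\<in>UNIV. ennreal (q n j k) * g k))"
      by (rule Suc)
    also have "\<dots> = (\<Sum>k\<in>UNIV. (\<Sum>j\<in>UNIV. ennreal (marginal q i n j) * ennreal (q n j k)) * g k)"
      by (simp add: sum_distrib_left sum_distrib_right mult.assoc) (rule sum.swap)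
    also have "\<dots> = (\<Sum>k\<in>UNIV. ennreal (marginal q i (Suc n) k) * g k)"
    proof (rule sum.cong[OF refl])
      fix k
      have "(\<Sum>j\<in>UNIV. ennreal (marginal q i n j) * ennreal (q n j k))
          = (\<Sum>j\<in>UNIV. ennreal (marginal q i n j * q n j k))"
        by (intro sum.cong refl ennreal_mult[symmetric] marginal_nonneg nonneg)
      also have "\<dots> = ennreal (marginal q i (Suc n) k)"
        by (simp add: sum_ennreal marginal_nonneg nonneg)
      finally show "(\<Sum>j\<in>UNIV. ennreal (marginal q i n j) * ennreal (q n j k)) * g k
          = ennreal (marginal q i (Suc n) k) * g k"
        by simp
    qed
    finally show ?case .
  qed
  have lim: "path_law p \<sigma> i = IT.PF.lim"
    by (simp add: path_law_def)
  show sets: ?B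
    by (simp add: lim)
  have [measurable]: "(\<lambda>\<omega>. \<omega> n) \<in> measurable (path_law p \<sigma> i) (count_space UNIV)" for n
    unfolding measurable_cong_sets[OF sets refl] by (rule measurable_component_singleton) simp
  \<comment> \<open>The limit measure is specified through the shortest initial segment of times
    that covers a given finite index set; for \<open>{n}\<close> this segment is
    \<open>{0..<Suc n}\<close>, which matches \<open>C\<close>.\<close>
  have up_to: "IT.up_to {n} = Suc n" for n
    unfolding IT.up_to_def by (rule Least_equality) (auto simp: not_less_eq_eq[symmetric])
  have nn: "(\<integral>\<^sup>+\<omega>. g (\<omega> n) \<partial>path_law p \<sigma> i) = (\<Sum>k\<in>UNIV. ennreal (marginal q i n k) * g k)"
    for n and g :: "'s \<Rightarrow> ennreal"
  proof -
    have m: "(\<lambda>\<omega>. g (\<omega> n)) \<in> borel_measurable (PiM {n} ?M)"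
      by (rule measurable_compose[OF measurable_component_singleton]) auto
    have r: "(\<lambda>x. restrict x {n}) \<in> measurable IT.PF.lim (PiM {n} ?M)"
      unfolding measurable_cong_sets[OF IT.PF.sets_lim refl]
      by (intro measurable_restrict measurable_component_singleton) auto
    have r': "(\<lambda>x. restrict x {n}) \<in> measurable (IT.C 0 (Suc n) (\<lambda>_. undefined)) (PiM {n} ?M)"
    proof (subst measurable_cong_sets[OF IT.sets_C refl])
      show "(\<lambda>x. restrict x {n}) \<in> measurable (PiM {0..<0 + Suc n} ?M) (PiM {n} ?M)"
        by (intro measurable_restrict measurable_component_singleton) auto
    qed (simp add: space_PiM)
    have "(\<integral>\<^sup>+\<omega>. g (\<omega> n) \<partial>path_law p \<sigma> i)
        = (\<integral>\<^sup>+\<omega>. g (\<omega> n) \<partial>distr IT.PF.lim (PiM {n} ?M) (\<lambda>x. restrict x {n}))"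
      unfolding lim by (subst nn_integral_distr[OF r]) (simp_all add: m)
    also have "\<dots> = (\<integral>\<^sup>+\<omega>. g (\<omega> n) \<partial>IT.C 0 (Suc n) (\<lambda>_. undefined))"
      unfolding IT.distr_lim[of "{n}", simplified] IT.CI_def up_to
      by (subst nn_integral_distr[OF r']) (simp_all add: m)
    finally show ?thesis
      unfolding C .
  qed
  show ?A
  proof (rule prob_spaceI)
    show "emeasure (path_law p \<sigma> i) (space (path_law p \<sigma> i)) = 1"
      using nn[of "\<lambda>_. 1" 0] by (simp add: of_bool_def if_distrib[of ennreal] cong: if_cong)
  qed
  show ?C
  proof (rule measure_eqI)
    fix A :: "'s set"
    have "emeasure (distr (path_law p \<sigma> i) (count_space UNIV) (\<lambda>\<omega>. \<omega> n)) A
        = (\<integral>\<^sup>+\<omega>. indicator A (\<omega> n) \<partial>path_law p \<sigma> i)"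
      by (subst nn_integral_distr[symmetric, where f = "indicator A" and M' = "count_space UNIV"]) auto
    then show "emeasure (distr (path_law p \<sigma> i) (count_space UNIV) (\<lambda>\<omega>. \<omega> n)) A
        = emeasure (point_measure UNIV (\<lambda>k. ennreal (marginal q i n k))) A"
      unfolding nn by (simp add: emeasure_point_measure_finite)
  qed (simp add: sets_point_measure)
qed

section \<open>The corkscrew form of the cone condition\<close>

text \<open>A ball centred on the axis at height \<open>r / 2\<close>, with radius a small multiple
  of \<open>r\<close>, stays above height \<open>r / 4\<close>, while its points leave the axis by
  less than \<open>e * r\<close>. This is at most the slope times the height, so it lies in the
  cone; by homogeneity \<open>e\<close> is independent of \<open>r\<close>.\<close>

lemma std_cone_contains_ball:
  assumes "0 < \<iota>" "\<iota> \<le> pi / 2"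
  obtains e where "0 < e"
    "\<And>r. 0 < r \<Longrightarrow> ball (axis (Max UNIV) (r / 2)) (e * r)
        \<subseteq> (std_cone \<iota> :: (real ^ 'l::{finite,linorder}) set) \<inter> ball 0 r"
proof -
  \<comment> \<open>The slope of the cone. For the half-space there is no lateral constraint and the
    tangent is meaningless, so any positive value serves there.\<close>
  define s where "s = (if \<iota> = pi / 2 then 1 else tan \<iota>)"
  have "0 < s"
    using assms by (auto simp: s_def intro!: tan_gt_zero)
  define e where "e = min (1 / 4) (s / 4)"
  have e: "0 < e" "e \<le> 1 / 4" "e \<le> s / 4"
    using \<open>0 < s\<close> by (auto simp: e_def)
  let ?m = "Max UNIV :: 'l"
  have "x \<in> std_cone \<iota> \<inter> ball 0 r" if "0 < r" "x \<in> ball (axis ?m (r / 2)) (e * r)" for r and x :: "(real, 'l) vec"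
  proof -
    define v where "v = x - axis ?m (r / 2)"
    have x: "x = axis ?m (r / 2) + v" by (simp add: v_def)
    have nv: "norm v < e * r" using that(2) by (simp add: v_def dist_norm norm_minus_commute)
    have "e * r \<le> r / 4" using e that(1) by simp
    have "\<bar>v $ ?m\<bar> < r / 4"
      using component_le_norm_cart[of v ?m] nv \<open>e * r \<le> r / 4\<close> by linarith
    then have xm: "r / 4 \<le> x $ ?m" unfolding x by (simp add: abs_less_iff)
    have "(\<Sum>j\<in>UNIV - {?m}. (x $ j)\<^sup>2) = (\<Sum>j\<in>UNIV - {?m}. (v $ j)\<^sup>2)"
      by (intro sum.cong refl) (simp add: x axis_def)
    also have "\<dots> \<le> (\<Sum>j\<in>UNIV. (v $ j)\<^sup>2)"
      by (intro sum_mono2) auto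
    also have "\<dots> = (norm v)\<^sup>2"
      by (simp add: norm_vec_def L2_set_def sum_nonneg)
    also have "\<dots> \<le> (e * r)\<^sup>2"
      using nv by (intro power_mono) auto
    also have "\<dots> \<le> (s * (x $ ?m))\<^sup>2"
    proof (intro power_mono)
      have "e * r \<le> s / 4 * r" using e that(1) by simp
      also have "\<dots> = s * (r / 4)" by simp
      also have "\<dots> \<le> s * (x $ ?m)" using xm \<open>0 < s\<close> by simp
      finally show "e * r \<le> s * (x $ ?m)" .
    qed (use e that in auto)
    finally have "(\<Sum>j\<in>UNIV - {?m}. (x $ j)\<^sup>2) \<le> s\<^sup>2 * (x $ ?m)\<^sup>2"
      by (simp add: power_mult_distrib)
    moreover have "norm x < r"
    proof -
      have "norm (axis ?m (r / 2)) = \<bar>r / 2\<bar>"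
        by (simp add: norm_eq_sqrt_inner inner_axis axis_nth real_sqrt_divide)
      then have "norm x \<le> r / 2 + norm v"
        using norm_triangle_ineq[of "axis ?m (r / 2)" v] that(1) by (simp add: x)
      then show ?thesis using nv \<open>e * r \<le> r / 4\<close> that(1) by linarith
    qed
    ultimately show ?thesis
      using xm that(1) by (auto simp: std_cone_def s_def)
  qed
  with e(1) show ?thesis by (intro that[of e]) auto
qed

text \<open>The interior corkscrew condition of geometric analysis. It replaces both the cones and
  the one-dimensional intervals by a single statement that bounds from below the volume of
  \<open>U\<close> near each of its points.\<close>

definition corkscrew_condition :: "'a::metric_space set \<Rightarrow> real \<Rightarrow> real \<Rightarrow> bool" where
  "corkscrew_condition U \<kappa> r0 \<longleftrightarrow>
     (\<forall>u\<in>U. \<forall>r. 0 < r \<longrightarrow> r \<le> r0 \<longrightarrow> (\<exists>z. ball z (\<kappa> * r) \<subseteq> U \<inter> ball u r))"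

text \<open>In higher dimension the ball inside the standard cone is rotated and translated to the
  vertex \<open>u\<close>; in dimension one, half of an interval of length \<open>r\<close> starting
  at \<open>u\<close> is already a ball.\<close>

lemma uniform_cone_condition_imp_corkscrew:
  fixes U :: "(real ^ 'l::{finite,linorder}) set"
  assumes "uniform_cone_condition U"
  obtains \<kappa> r0 where "0 < \<kappa>" "0 < r0" "corkscrew_condition U \<kappa> r0"
proof (cases "CARD('l) > 1")
  case True
  then obtain \<theta> \<iota> where \<theta>: "0 < \<theta>" and \<iota>: "0 < \<iota>" "\<iota> \<le> pi / 2"
    and cone: "\<And>u. u \<in> U \<Longrightarrow> \<exists>C. is_cone_at u \<iota> C \<and> C \<inter> ball u \<theta> \<subseteq> U"
    using assms unfolding uniform_cone_condition_def by auto
  obtain e where e: "0 < e" and ball: "\<And>r. 0 < r \<Longrightarrow> ball (axis (Max UNIV) (r / 2)) (e * r)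
        \<subseteq> (std_cone \<iota> :: (real, 'l) vec set) \<inter> ball 0 r"
    using std_cone_contains_ball[OF \<iota>] by metis
  have "\<exists>z. ball z (e * r) \<subseteq> U \<inter> ball u r" if "u \<in> U" "0 < r" "r \<le> \<theta>" for u r
  proof -
    obtain R where R: "rotation_matrix R" and RU: "(\<lambda>v. u + R *v v) ` std_cone \<iota> \<inter> ball u \<theta> \<subseteq> U"
      using cone[OF \<open>u \<in> U\<close>] unfolding is_cone_at_def by auto
    have orth: "orthogonal_matrix R" using R by (simp add: rotation_matrix_def)
    have norm_R: "norm (R *v v) = norm v" for v
      using orth orthogonal_transformation_matrix[of "(*v) R"] orthogonal_transformation_norm by auto
    let ?w = "axis (Max UNIV) (r / 2) :: (real, 'l) vec"
    have "x \<in> U \<inter> ball u r" if x: "x \<in> ball (u + R *v ?w) (e * r)" for x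
    proof -
      \<comment> \<open>Pulling \<open>x\<close> back by the inverse rotation places it in the ball
        inside the standard cone; lengths are preserved.\<close>
      define v where "v = transpose R *v (x - u)"
      have Rv: "R *v v = x - u"
        using orth by (simp add: v_def matrix_vector_mul_assoc orthogonal_matrix_def del: transpose_matrix_vector)
      have "norm (v - ?w) = norm (x - (u + R *v ?w))"
        by (subst norm_R[symmetric]) (simp add: matrix_vector_mult_diff_distrib Rv algebra_simps)
      also have "\<dots> < e * r" using x by (simp add: dist_norm norm_minus_commute)
      finally have "v \<in> ball ?w (e * r)" by (simp add: dist_norm norm_minus_commute)
      with ball[OF \<open>0 < r\<close>] have v: "v \<in> std_cone \<iota>" "norm v < r" by auto
      have "x = u + R *v v" by (simp add: Rv)
      moreover from this have "norm (x - u) < r" using v norm_R by simp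
      ultimately show ?thesis
        using v RU \<open>r \<le> \<theta>\<close> by (auto simp: dist_norm norm_minus_commute norm_R)
    qed
    then show ?thesis by blast
  qed
  with e \<theta> show ?thesis by (intro that[of e \<theta>]) (auto simp: corkscrew_condition_def)
next
  case False
  then obtain \<theta> where \<theta>: "0 < \<theta>"
    and box: "\<And>u. u \<in> U \<Longrightarrow> cbox (u - vec \<theta>) u \<subseteq> U \<or> cbox u (u + vec \<theta>) \<subseteq> U"
    using assms unfolding uniform_cone_condition_def by auto
  have "CARD('l) = 1"
    using False zero_less_card_finite[where 'a = 'l] by linarith
  then have norm_vec: "norm (vec x :: (real, 'l) vec) = \<bar>x\<bar>" for x
    by (simp add: norm_vec_def L2_set_def)
  have "\<exists>z. ball z (1 / 2 * r) \<subseteq> U \<inter> ball u r" if "u \<in> U" "0 < r" "r \<le> \<theta>" for u r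
  proof -
    \<comment> \<open>The sign \<open>\<sigma>\<close> records on which side of \<open>u\<close> the
      interval lies, so that both cases share one argument with centre
      \<open>u + vec (\<sigma> * (r / 2))\<close>.\<close>
    obtain \<sigma> where \<sigma>: "\<bar>\<sigma>\<bar> = 1" and
      sub: "\<And>x. (\<And>j. 0 \<le> \<sigma> * (x $ j - u $ j) \<and> \<sigma> * (x $ j - u $ j) \<le> \<theta>) \<Longrightarrow> x \<in> U"
    proof (rule disjE[OF box[OF \<open>u \<in> U\<close>]])
      assume "cbox (u - vec \<theta>) u \<subseteq> U"
      then show thesis
        by (intro that[of "-1"]) (auto simp: subset_eq mem_box_cart algebra_simps)
    next
      assume "cbox u (u + vec \<theta>) \<subseteq> U"
      then show thesis
        by (intro that[of 1]) (auto simp: subset_eq mem_box_cart algebra_simps)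
    qed
    have "x \<in> U \<inter> ball u r" if x: "x \<in> ball (u + vec (\<sigma> * (r / 2))) (1 / 2 * r)" for x
    proof -
      define v where "v = x - (u + vec (\<sigma> * (r / 2)))"
      have nv: "norm v < r / 2" using x by (simp add: v_def dist_norm norm_minus_commute)
      have "\<sigma> * \<sigma> = 1" using \<sigma> by (metis abs_mult_self_eq mult_1)
      have "0 \<le> \<sigma> * (x $ j - u $ j) \<and> \<sigma> * (x $ j - u $ j) \<le> r" for j
      proof -
        have "\<sigma> * (x $ j - u $ j) = \<sigma> * \<sigma> * (r / 2) + \<sigma> * v $ j"
          by (simp add: v_def algebra_simps)
        also have "\<dots> = r / 2 + \<sigma> * v $ j" using \<open>\<sigma> * \<sigma> = 1\<close> by simp
        finally have *: "\<sigma> * (x $ j - u $ j) = r / 2 + \<sigma> * v $ j" .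
        have "\<bar>\<sigma> * v $ j\<bar> < r / 2"
          using component_le_norm_cart[of v j] nv \<sigma> by (simp add: abs_mult)
        then show ?thesis unfolding * by linarith
      qed
      then have "x \<in> U" using sub \<open>r \<le> \<theta>\<close> by (meson order_trans)
      moreover have "norm (x - u) < r"
      proof -
        have "norm (x - u) \<le> norm (vec (\<sigma> * (r / 2)) :: (real, 'l) vec) + norm v"
          using norm_triangle_ineq[of "vec (\<sigma> * (r / 2))" v] by (simp add: v_def)
        then show ?thesis using nv \<open>0 < r\<close> \<sigma> by (simp add: norm_vec abs_mult)
      qed
      ultimately show ?thesis by (simp add: dist_norm norm_minus_commute)
    qed
    then show ?thesis by blast
  qed
  with \<theta> show ?thesis by (intro that[of "1 / 2" \<theta>]) (auto simp: corkscrew_condition_def)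
qed

section \<open>A radius that dominates its own logarithmic bound\<close>

lemma log_growth_bound:
  fixes A B c d :: real
  assumes "0 \<le> A" "0 \<le> B" "0 < c" "0 \<le> d"
  obtains R where "0 \<le> R" "A + B * ln (c + d * R) \<le> R"
proof -
  \<comment> \<open>The logarithm lies below each of its tangent lines. The line of slope
    \<open>\<eta>\<close> makes the bound grow in \<open>R\<close> with rate at most
    \<open>1 / 2\<close>, and \<open>R = 2 * \<bar>A + X\<bar>\<close> then absorbs the constant
    part.\<close>
  define \<eta> where "\<eta> = 1 / (2 * (B * d + 1))"
  have \<eta>: "0 < \<eta>" "B * \<eta> * d \<le> 1 / 2"
  proof -
    have "0 \<le> B * d" using assms by simp
    then show "0 < \<eta>" "B * \<eta> * d \<le> 1 / 2" by (auto simp: \<eta>_def field_simps)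
  qed
  define X where "X = B * (\<eta> * c - ln \<eta>)"
  define R where "R = 2 * \<bar>A + X\<bar>"
  have R: "0 \<le> R" by (simp add: R_def)
  have pos: "0 < c + d * R" using assms R by (simp add: add_pos_nonneg)
  have "ln (c + d * R) = ln (\<eta> * (c + d * R)) - ln \<eta>"
    using pos \<eta> by (simp add: ln_mult)
  also have "\<dots> \<le> \<eta> * (c + d * R) - ln \<eta>"
    using ln_le_minus_one[of "\<eta> * (c + d * R)"] pos \<eta> by simp
  finally have "B * ln (c + d * R) \<le> B * (\<eta> * (c + d * R) - ln \<eta>)"
    using assms by (intro mult_left_mono) auto
  also have "\<dots> = X + B * \<eta> * d * R" by (simp add: X_def algebra_simps)
  also have "\<dots> \<le> X + 1 / 2 * R"
    using mult_right_mono[OF \<eta>(2) R] by simp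
  finally have "A + B * ln (c + d * R) \<le> R" using abs_ge_self[of "A + X"] by (simp add: R_def)
  with R show ?thesis by (rule that)
qed

section \<open>Integration, densities and entropy on a compact action set\<close>

lemma integrable_leb_on:
  fixes h :: "real ^ 'l \<Rightarrow> real"
  assumes "compact U" "continuous_on U h"
  shows "integrable (leb_on U) h"
  using borel_integrable_compact[OF assms] assms(1)
  by (subst integrable_restrict_space) (auto intro: borel_closed compact_imp_closed simp: set_integrable_def)

lemma finite_measure_leb_on:
  assumes "compact U" shows "finite_measure (leb_on U)"
  using assms emeasure_compact_finite[of U]
  by (intro finite_measureI) (auto simp: emeasure_restrict_space space_restrict_space borel_compact less_top)

text \<open>Dominated convergence: on the compact set \<open>K \<times> U\<close> the integrand is
  bounded by a constant, which is integrable because \<open>U\<close> has finite measure.\<close>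

lemma continuous_on_integral_leb_on:
  fixes h :: "'a::metric_space \<Rightarrow> real ^ 'l \<Rightarrow> real"
  assumes U: "compact U" and K: "compact K" and h: "continuous_on (K \<times> U) (\<lambda>(y, u). h y u)"
  shows "continuous_on K (\<lambda>y. \<integral>u. h y u \<partial>leb_on U)"
proof -
  interpret finite_measure "leb_on U" by (rule finite_measure_leb_on[OF U])
  have cont_h: "continuous_on U (h y)" if "y \<in> K" for y
  proof -
    have "continuous_on U (\<lambda>u. (y, u))" by (intro continuous_intros)
    from continuous_on_compose2[OF h this] that show ?thesis by auto
  qed
  have "compact ((\<lambda>(y, u). h y u) ` (K \<times> U))"
    by (intro compact_continuous_image h compact_Times K U)
  then obtain B where B: "\<And>y u. y \<in> K \<Longrightarrow> u \<in> U \<Longrightarrow> \<bar>h y u\<bar> \<le> B"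
    using compact_imp_bounded bounded_iff by (metis (mono_tags, lifting) SigmaI case_prod_conv image_eqI real_norm_def)
  show ?thesis
    unfolding continuous_on_sequentially comp_def
  proof (intro allI ballI impI, elim conjE)
    fix s :: "nat \<Rightarrow> 'a" and y assume y: "y \<in> K" and s: "\<forall>n. s n \<in> K" "s \<longlonglongrightarrow> y"
    show "(\<lambda>n. \<integral>u. h (s n) u \<partial>leb_on U) \<longlonglongrightarrow> (\<integral>u. h y u \<partial>leb_on U)"
    proof (rule integral_dominated_convergence)
      show "h y \<in> borel_measurable (leb_on U)" "h (s n) \<in> borel_measurable (leb_on U)" for n
        using integrable_leb_on[OF U cont_h] y s by auto
      show "integrable (leb_on U) (\<lambda>_. B)" by simp
      show "AE u in leb_on U. norm (h (s n) u) \<le> B" for n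
        using B s by (intro AE_I2) (auto simp: space_restrict_space)
      show "AE u in leb_on U. (\<lambda>n. h (s n) u) \<longlonglongrightarrow> h y u"
      proof (intro AE_I2)
        fix u assume "u \<in> space (leb_on U)"
        then have u: "u \<in> U" by (simp add: space_restrict_space)
        have "continuous_on K (\<lambda>y. h y u)"
        proof -
          have "continuous_on K (\<lambda>y. (y, u))" by (intro continuous_intros)
          from continuous_on_compose2[OF h this] u show ?thesis by auto
        qed
        then show "(\<lambda>n. h (s n) u) \<longlonglongrightarrow> h y u"
          using y s by (auto simp: continuous_on_sequentially comp_def)
      qed
    qed
  qed
qed

lemma densitiesD:
  assumes "\<rho> \<in> densities U"
  shows "\<rho> \<in> borel_measurable (leb_on U)" "\<And>u. u \<in> U \<Longrightarrow> 0 \<le> \<rho> u"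
    and "integrable (leb_on U) \<rho>" "(\<integral>u. \<rho> u \<partial>leb_on U) = 1"
proof -
  show m: "\<rho> \<in> borel_measurable (leb_on U)" and nn: "\<And>u. u \<in> U \<Longrightarrow> 0 \<le> \<rho> u"
    using assms by (auto simp: densities_def)
  have AE: "AE u in leb_on U. 0 \<le> \<rho> u"
    using nn by (intro AE_I2) (simp add: space_restrict_space)
  have 1: "(\<integral>\<^sup>+u. ennreal (\<rho> u) \<partial>leb_on U) = ennreal 1"
    using assms by (simp add: densities_def)
  show "integrable (leb_on U) \<rho>"
    using integrableI_nn_integral_finite[OF m AE 1] .
  show "(\<integral>u. \<rho> u \<partial>leb_on U) = 1"
    using integral_eq_nn_integral[OF m AE] 1 by simp
qed

lemma densitiesI:
  assumes "integrable (leb_on U) \<rho>" "\<And>u. u \<in> U \<Longrightarrow> 0 \<le> \<rho> u" "(\<integral>u. \<rho> u \<partial>leb_on U) = 1"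
  shows "\<rho> \<in> densities U"
proof -
  have "AE u in leb_on U. 0 \<le> \<rho> u"
    using assms(2) by (intro AE_I2) (simp add: space_restrict_space)
  from nn_integral_eq_integral[OF assms(1) this] assms show ?thesis
    by (auto simp: densities_def)
qed

lemma integral_law_of:
  fixes h :: "real ^ 'l \<Rightarrow> real"
  assumes "\<rho> \<in> densities U" "h \<in> borel_measurable (leb_on U)"
  shows "(\<integral>u. h u \<partial>law_of U \<rho>) = (\<integral>u. \<rho> u * h u \<partial>leb_on U)"
  unfolding law_of_def using densitiesD[OF assms(1)] assms(2)
  by (subst integral_density) (auto simp: space_restrict_space)

lemma law_of_in_prob_algebra:
  assumes "\<rho> \<in> densities U"
  shows "law_of U \<rho> \<in> space (prob_algebra (restrict_space borel U))"
proof -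
  have "sets (leb_on U) = sets (restrict_space borel U)"
    by (simp add: sets_restrict_space)
  moreover have "emeasure (law_of U \<rho>) (space (law_of U \<rho>)) = 1"
    using assms densitiesD(1)[OF assms]
    by (simp add: law_of_def emeasure_density densities_def nn_integral_set_ennreal cong: nn_integral_cong)
  ultimately show ?thesis
    by (auto simp: space_prob_algebra law_of_def intro: prob_spaceI)
qed

section \<open>Entropy and Gibbs' inequality\<close>

lemma neg_ln_mult_le_one: "- (ln x * x) \<le> 1" if "0 \<le> x" for x :: real
proof (cases "x = 0")
  case False
  with that have "0 < x" by simp
  have "- ln x \<le> 1 / x - 1"
    using ln_le_minus_one[of "1 / x"] \<open>0 < x\<close> by (simp add: ln_div)
  then have "- ln x * x \<le> (1 / x - 1) * x"
    using that by (rule mult_right_mono)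
  with \<open>0 < x\<close> show ?thesis by (simp add: algebra_simps)
qed simp

text \<open>The integrand \<open>- ln \<rho> * \<rho>\<close> is at most \<open>1\<close> and
  \<open>U\<close> has finite measure, so only its negative part can have infinite integral. Finite
  entropy thus means integrability, and the extended value is then an ordinary integral.\<close>

lemma dens_entropy_gt_MInf_iff:
  assumes "compact U" "\<rho> \<in> densities U"
  shows "dens_entropy U \<rho> > -\<infinity> \<longleftrightarrow> integrable (leb_on U) (\<lambda>u. ln (\<rho> u) * \<rho> u)" (is "?A \<longleftrightarrow> ?B")
    and "dens_entropy U \<rho> > -\<infinity> \<Longrightarrow>
      real_of_ereal (dens_entropy U \<rho>) = - (\<integral>u. ln (\<rho> u) * \<rho> u \<partial>leb_on U)"
proof -
  interpret finite_measure "leb_on U" by (rule finite_measure_leb_on[OF assms(1)])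
  let ?h = "\<lambda>u. ln (\<rho> u) * \<rho> u"
  have [measurable]: "\<rho> \<in> borel_measurable (leb_on U)" by (rule densitiesD[OF assms(2)])
  have "(\<integral>\<^sup>+u. ennreal (- ?h u) \<partial>leb_on U) \<le> (\<integral>\<^sup>+u. 1 \<partial>leb_on U)"
    using neg_ln_mult_le_one densitiesD(2)[OF assms(2)]
    by (intro nn_integral_mono) (auto simp: space_restrict_space)
  also have "\<dots> < \<infinity>"
    using emeasure_finite[of "space (leb_on U)"] by (simp add: less_top[symmetric])
  finally have neg: "(\<integral>\<^sup>+u. ennreal (- ?h u) \<partial>leb_on U) \<noteq> \<infinity>"
    by simp
  then obtain a where a: "0 \<le> a" "(\<integral>\<^sup>+u. ennreal (- ?h u) \<partial>leb_on U) = ennreal a"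
    by (cases "\<integral>\<^sup>+u. ennreal (- ?h u) \<partial>leb_on U" rule: ennreal_cases) auto
  have int_iff: "?B \<longleftrightarrow> (\<integral>\<^sup>+u. ennreal (?h u) \<partial>leb_on U) \<noteq> \<infinity>"
    using neg by (simp add: real_integrable_def)
  show iff: "?A \<longleftrightarrow> ?B"
  proof (cases "\<integral>\<^sup>+u. ennreal (?h u) \<partial>leb_on U" rule: ennreal_cases)
    case (real b)
    then show ?thesis unfolding int_iff dens_entropy_def by (simp add: a)
  next
    case top
    then show ?thesis unfolding int_iff dens_entropy_def by (simp add: a)
  qed
  assume ?A
  then have int: ?B using iff by simp
  then obtain b where b: "0 \<le> b" "(\<integral>\<^sup>+u. ennreal (?h u) \<partial>leb_on U) = ennreal b"
    unfolding int_iff by (cases "\<integral>\<^sup>+u. ennreal (?h u) \<partial>leb_on U" rule: ennreal_cases) auto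
  show "real_of_ereal (dens_entropy U \<rho>) = - (\<integral>u. ?h u \<partial>leb_on U)"
    unfolding real_lebesgue_integral_def[OF int] dens_entropy_def a b using a b by simp
qed

text \<open>The Radon-Nikodym derivative of \<open>law_of U \<rho>\<close> agrees with
  \<open>\<rho>\<close> almost everywhere, and the entropy does not see null sets.\<close>

lemma entropy_of_law_of:
  assumes "compact U" "\<rho> \<in> densities U" "dens_entropy U \<rho> > -\<infinity>"
  shows "entropy_of U (law_of U \<rho>) = - (\<integral>u. ln (\<rho> u) * \<rho> u \<partial>leb_on U)"
proof -
  interpret finite_measure "leb_on U" by (rule finite_measure_leb_on[OF assms(1)])
  have "AE u in leb_on U. ennreal (\<rho> u) = RN_deriv (leb_on U) (law_of U \<rho>) u"
    using densitiesD(1)[OF assms(2)] by (intro RN_deriv_unique) (auto simp: law_of_def)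
  moreover have "AE u in leb_on U. 0 \<le> \<rho> u"
    using densitiesD(2)[OF assms(2)] by (intro AE_I2) (simp add: space_restrict_space)
  ultimately have AE: "AE u in leb_on U. enn2real (RN_deriv (leb_on U) (law_of U \<rho>) u) = \<rho> u"
    by eventually_elim (metis enn2real_ennreal)
  have "dens_entropy U (\<lambda>u. enn2real (RN_deriv (leb_on U) (law_of U \<rho>) u)) = dens_entropy U \<rho>"
    unfolding dens_entropy_def using AE
    by (intro arg_cong2[where f = minus] arg_cong[where f = enn2ereal] nn_integral_cong_AE) auto
  then show ?thesis
    using dens_entropy_gt_MInf_iff(2)[OF assms] by (simp add: entropy_of_def)
qed

text \<open>Gibbs' inequality, that is, nonnegativity of relative entropy. The bound
  \<open>ln t \<le> t - 1\<close> at \<open>t = \<gamma> x / \<rho> x\<close>, multiplied by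
  \<open>\<rho> x\<close>, is integrated; the right-hand side vanishes because the masses agree.
  Points with \<open>\<rho> x = 0\<close> contribute \<open>0\<close> on the left.\<close>

lemma entropy_inequality:
  fixes \<rho> \<gamma> :: "'a \<Rightarrow> real"
  assumes "integrable M \<rho>" "integrable M \<gamma>" "(\<integral>x. \<rho> x \<partial>M) = (\<integral>x. \<gamma> x \<partial>M)"
    and "\<And>x. x \<in> space M \<Longrightarrow> 0 \<le> \<rho> x" "\<And>x. x \<in> space M \<Longrightarrow> 0 < \<gamma> x"
    and "integrable M (\<lambda>x. ln (\<rho> x) * \<rho> x)" "integrable M (\<lambda>x. ln (\<gamma> x) * \<rho> x)"
  shows "(\<integral>x. ln (\<gamma> x) * \<rho> x \<partial>M) \<le> (\<integral>x. ln (\<rho> x) * \<rho> x \<partial>M)"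
proof -
  have "(\<integral>x. ln (\<gamma> x) * \<rho> x - ln (\<rho> x) * \<rho> x \<partial>M) \<le> (\<integral>x. \<gamma> x - \<rho> x \<partial>M)"
  proof (rule integral_mono)
    fix x assume x: "x \<in> space M"
    show "ln (\<gamma> x) * \<rho> x - ln (\<rho> x) * \<rho> x \<le> \<gamma> x - \<rho> x"
    proof (cases "\<rho> x = 0")
      case False
      with x assms have pos: "0 < \<rho> x" "0 < \<gamma> x" by (auto simp: less_le)
      have "ln (\<gamma> x) - ln (\<rho> x) \<le> \<gamma> x / \<rho> x - 1"
        using ln_le_minus_one[of "\<gamma> x / \<rho> x"] pos by (simp add: ln_div)
      then have "(ln (\<gamma> x) - ln (\<rho> x)) * \<rho> x \<le> (\<gamma> x / \<rho> x - 1) * \<rho> x"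
        using pos by (intro mult_right_mono) auto
      with pos show ?thesis by (simp add: algebra_simps)
    qed (use x assms in \<open>auto simp: less_imp_le\<close>)
  qed (use assms in auto)
  then show ?thesis using assms by simp
qed

lemma integral_relaxed_control:
  fixes h :: "real ^ 'l \<Rightarrow> real"
  assumes \<mu>: "\<mu> \<in> space (prob_algebra (restrict_space borel U))"
    and h: "continuous_on U h" "\<And>u. u \<in> U \<Longrightarrow> \<bar>h u\<bar> \<le> B"
  shows "integrable \<mu> h" "\<bar>\<integral>u. h u \<partial>\<mu>\<bar> \<le> B"
proof -
  interpret prob_space \<mu> using \<mu> by (simp add: space_prob_algebra)
  have sets: "sets \<mu> = sets (restrict_space borel U)" using \<mu> by (simp add: space_prob_algebra)
  have sp: "space \<mu> = U" using sets_eq_imp_space_eq[OF sets] by (simp add: space_restrict_space)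
  have m: "h \<in> borel_measurable \<mu>"
    using borel_measurable_continuous_on_restrict[OF h(1)] by (simp cong: measurable_cong_sets add: sets)
  show int: "integrable \<mu> h"
    using h(2) by (intro integrable_const_bound[of _ B] m AE_I2) (auto simp: sp)
  have "\<bar>\<integral>u. h u \<partial>\<mu>\<bar> \<le> (\<integral>u. \<bar>h u\<bar> \<partial>\<mu>)"
    using integral_norm_bound[of \<mu> h] by simp
  also have "\<dots> \<le> (\<integral>u. B \<partial>\<mu>)"
    using h(2) int by (intro integral_mono) (auto simp: sp)
  also have "\<dots> = B" by (simp add: prob_space)
  finally show "\<bar>\<integral>u. h u \<partial>\<mu>\<bar> \<le> B" .
qed

section \<open>The value functions as series\<close>

definition transition ::
  "(real ^ 'l \<Rightarrow> real ^ 's ^ 's) \<Rightarrow> ('s \<Rightarrow> (real ^ 'l) measure) \<Rightarrow> 's \<Rightarrow> 's \<Rightarrow> real" where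
  "transition p \<pi> j k = (\<integral>u. p u $ j $ k \<partial>\<pi> j)"

definition stage_reward ::
  "(real ^ 'l) set \<Rightarrow> (real \<Rightarrow> 's \<Rightarrow> real ^ 'l \<Rightarrow> real) \<Rightarrow> (real \<Rightarrow> real) \<Rightarrow> real
     \<Rightarrow> real \<Rightarrow> ('s \<Rightarrow> (real ^ 'l) measure) \<Rightarrow> 's \<Rightarrow> real" where
  "stage_reward U f \<delta> lam t \<pi> j = avg_reward f (\<pi> j) t j + lam * \<delta> t * entropy_of U (\<pi> j)"

text \<open>The hypotheses in quantitative form: finiteness of the total reward and discount becomes
  a summable majorant \<open>F\<close> and summability of \<open>\<delta>\<close> at integer times,
  the difference quotients give one Lipschitz constant \<open>L\<close>, and the geometry of
  \<open>U\<close> enters through \<open>\<kappa>\<close> and \<open>r0\<close>.\<close>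

locale regularized_control =
  fixes U :: "(real ^ 'l) set"
    and p :: "real ^ 'l \<Rightarrow> real ^ 's::finite ^ 's"
    and f :: "real \<Rightarrow> 's \<Rightarrow> real ^ 'l \<Rightarrow> real"
    and \<delta> :: "real \<Rightarrow> real" and lam :: real
    and F :: "nat \<Rightarrow> real" and L \<kappa> r0 :: real
  assumes compact_U: "compact U" and U_pos: "emeasure lborel U > 0"
    and stochastic: "\<And>u. u \<in> U \<Longrightarrow> stochastic_matrix (p u)"
    and \<delta>_nonneg: "\<And>t::nat. 0 \<le> \<delta> (real t)" and \<delta>_0: "\<delta> 0 = 1"
    and summable_\<delta>: "summable (\<lambda>t::nat. \<delta> (real t))"
    and f_bound: "\<And>t i u. u \<in> U \<Longrightarrow> \<bar>f (real t) i u\<bar> \<le> F t" and summable_F: "summable F"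
    and f_lipschitz: "\<And>t i. L-lipschitz_on U (f (real t) i)"
    and p_lipschitz: "\<And>i. L-lipschitz_on U (\<lambda>u. p u $ i)"
    and lam_pos: "0 < lam"
    and \<kappa>_pos: "0 < \<kappa>" and r0_pos: "0 < r0" and corkscrew: "corkscrew_condition U \<kappa> r0"
begin

sublocale leb: finite_measure "leb_on U"
  by (rule finite_measure_leb_on[OF compact_U])

lemma leb_pos: "emeasure (leb_on U) (space (leb_on U)) \<noteq> 0"
  using U_pos compact_U by (simp add: space_restrict_space emeasure_restrict_space borel_compact)

lemma U_nonempty: "U \<noteq> {}"
  using U_pos by auto

lemma f_cont: "continuous_on U (f (real t) i)"
  using f_lipschitz lipschitz_on_continuous_on by blast

lemma f0_cont: "continuous_on U (f 0 i)"
  using f_cont[of 0] by simp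

lemma p_row_cont: "continuous_on U (\<lambda>u. p u $ i)"
  using p_lipschitz lipschitz_on_continuous_on by blast

lemma p_cont: "continuous_on U (\<lambda>u. p u $ i $ j)"
  using p_row_cont by (rule continuous_on_component)

lemma p_nonneg: "u \<in> U \<Longrightarrow> 0 \<le> p u $ i $ j"
  and p_sum: "u \<in> U \<Longrightarrow> (\<Sum>j\<in>UNIV. p u $ i $ j) = 1"
  using stochastic by (auto simp: stochastic_matrix_def)

lemma p_le_1: "u \<in> U \<Longrightarrow> p u $ i $ j \<le> 1"
  using p_sum[of u i] p_nonneg[of u i] member_le_sum[of j UNIV "\<lambda>j. p u $ i $ j"] by simp

lemma L_nonneg: "0 \<le> L"
  using f_lipschitz by (rule lipschitz_on_nonneg)

lemma F_nonneg: "0 \<le> F t"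
  using f_bound[of _ t undefined] U_nonempty by (metis abs_ge_zero all_not_in_conv order_trans)

context
  fixes \<mu> :: "(real ^ 'l) measure"
  assumes \<mu>: "\<mu> \<in> space (prob_algebra (restrict_space borel U))"
begin

lemma space_control: "space \<mu> = U"
  using \<mu> sets_eq_imp_space_eq[of \<mu> "restrict_space borel U"]
  by (simp add: space_prob_algebra space_restrict_space)

lemma integrable_p: "integrable \<mu> (\<lambda>u. p u $ i $ j)"
  using p_nonneg p_le_1 by (intro integral_relaxed_control(1)[OF \<mu> p_cont, of _ _ 1]) auto

lemma integrable_f: "integrable \<mu> (f (real t) i)"
  using f_bound by (intro integral_relaxed_control(1)[OF \<mu> f_cont, of _ _ "F t"]) auto

lemma abs_avg_reward_le: "\<bar>avg_reward f \<mu> (real t) i\<bar> \<le> F t"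
  unfolding avg_reward_def
  using f_bound by (intro integral_relaxed_control(2)[OF \<mu> f_cont]) auto

end

lemma transition_nonneg: "\<pi> \<in> relaxed_controls U \<Longrightarrow> 0 \<le> transition p \<pi> j k"
  unfolding transition_def relaxed_controls_def
  by (intro integral_nonneg_AE AE_I2 p_nonneg) (auto simp: space_control)

lemma transition_sum:
  assumes "\<pi> \<in> relaxed_controls U"
  shows "(\<Sum>k\<in>UNIV. transition p \<pi> j k) = 1"
proof -
  have \<pi>: "\<pi> j \<in> space (prob_algebra (restrict_space borel U))"
    using assms by (simp add: relaxed_controls_def)
  then interpret prob_space "\<pi> j" by (simp add: space_prob_algebra)
  have "(\<Sum>k\<in>UNIV. transition p \<pi> j k) = (\<integral>u. (\<Sum>k\<in>UNIV. p u $ j $ k) \<partial>\<pi> j)"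
    unfolding transition_def by (intro Bochner_Integration.integral_sum[symmetric] integrable_p[OF \<pi>])
  also have "\<dots> = (\<integral>u. 1 \<partial>\<pi> j)"
    by (intro Bochner_Integration.integral_cong refl p_sum) (simp add: space_control[OF \<pi>])
  finally show ?thesis by (simp add: prob_space)
qed

text \<open>With entropies bounded by \<open>B\<close>, the stage rewards are dominated, uniformly
  over states, by a summable sequence. Hence expectation and infinite sum may be interchanged, and
  each expected stage reward is a finite sum over the marginal law. Afterwards value functions are
  plain series and the path measure disappears.\<close>

lemma shifted_value_sums:
  fixes s :: nat
  assumes \<sigma>: "\<And>t. \<sigma> t \<in> relaxed_controls U" and B: "\<And>t j. \<bar>entropy_of U (\<sigma> t j)\<bar> \<le> B"
  defines "a \<equiv> \<lambda>i n. \<Sum>k\<in>UNIV. marginal (\<lambda>t. transition p (\<sigma> t)) i n k *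
      stage_reward U f \<delta> lam (real (s + n)) (\<sigma> n) k"
  shows shifted_value_term_bound: "\<bar>a i n\<bar> \<le> F (s + n) + lam * \<delta> (real (s + n)) * B"
    and summable_shifted_value: "summable (a i)"
    and shifted_value_eq_suminf: "shifted_value U p f \<delta> lam s \<sigma> i = suminf (a i)"
proof -
  let ?q = "\<lambda>t. transition p (\<sigma> t)" and ?R = "\<lambda>n. stage_reward U f \<delta> lam (real (s + n)) (\<sigma> n)"
  let ?b = "\<lambda>n. F (s + n) + lam * \<delta> (real (s + n)) * B"
  have q_nonneg: "0 \<le> ?q t j k" for t j k by (rule transition_nonneg[OF \<sigma>])
  have q_sum: "(\<Sum>k\<in>UNIV. ?q t j k) = 1" for t j by (rule transition_sum[OF \<sigma>])
  have R: "\<bar>?R n j\<bar> \<le> ?b n" for n j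
  proof -
    have "\<sigma> n j \<in> space (prob_algebra (restrict_space borel U))"
      using \<sigma>[of n] by (simp add: relaxed_controls_def)
    note abs_avg_reward_le[OF this, of "s + n" j]
    moreover have "\<bar>lam * \<delta> (real (s + n)) * entropy_of U (\<sigma> n j)\<bar> \<le> lam * \<delta> (real (s + n)) * B"
      using B[of n j] lam_pos \<delta>_nonneg[of "s + n"]
      by (simp only: abs_mult) (intro mult_mono, auto)
    ultimately show ?thesis unfolding stage_reward_def by linarith
  qed
  have summable_b: "summable ?b"
    by (intro summable_add summable_mult2 summable_mult)
       (use summable_iff_shift[of F s] summable_F summable_iff_shift[of "\<lambda>t. \<delta> (real t)" s] summable_\<delta>
         in \<open>simp_all only: add.commute[of _ s]\<close>)
  show abs_a: "\<bar>a i n\<bar> \<le> ?b n" for i n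
  proof -
    have "\<bar>a i n\<bar> \<le> (\<Sum>k\<in>UNIV. marginal ?q i n k * ?b n)"
      unfolding a_def using R marginal_nonneg[of ?q, OF q_nonneg]
      by (intro order_trans[OF sum_abs] sum_mono) (auto simp: abs_mult intro!: mult_mono)
    also have "\<dots> = ?b n"
      by (simp add: sum_marginal[of ?q, OF q_sum] flip: sum_distrib_right)
    finally show ?thesis .
  qed
  show "summable (a i)" for i
    using abs_a by (intro summable_comparison_test'[OF summable_b]) auto
  interpret path: prob_space "path_law p \<sigma> i"
    by (rule prob_space_path_law) (use q_nonneg q_sum in \<open>simp_all add: transition_def\<close>)
  have distr: "distr (path_law p \<sigma> i) (count_space UNIV) (\<lambda>\<omega>. \<omega> n)
      = point_measure UNIV (\<lambda>k. ennreal (marginal ?q i n k))" for n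
    unfolding transition_def
    by (rule distr_path_law) (use q_nonneg q_sum in \<open>simp_all add: transition_def\<close>)
  have sets: "sets (path_law p \<sigma> i) = sets (PiM UNIV (\<lambda>_. count_space UNIV))"
    by (rule sets_path_law) (use q_nonneg q_sum in \<open>simp_all add: transition_def\<close>)
  have coord[measurable]: "(\<lambda>\<omega>. \<omega> n) \<in> measurable (path_law p \<sigma> i) (count_space UNIV)" for n
    unfolding measurable_cong_sets[OF sets refl] by (rule measurable_component_singleton) simp
  have meas: "(\<lambda>\<omega>. h (\<omega> n)) \<in> borel_measurable (path_law p \<sigma> i)" for n and h :: "'s \<Rightarrow> real"
    by (rule measurable_compose[OF coord]) simp
  have expect: "(\<integral>\<omega>. h (\<omega> n) \<partial>path_law p \<sigma> i) = (\<Sum>k\<in>UNIV. marginal ?q i n k * h k)"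
    for n and h :: "'s \<Rightarrow> real"
    using integral_distr[OF coord[of n], of h]
    by (simp add: distr lebesgue_integral_point_measure_finite marginal_nonneg[of ?q, OF q_nonneg])
  have int: "integrable (path_law p \<sigma> i) (\<lambda>\<omega>. ?R n (\<omega> n))" for n
    using R by (intro path.integrable_const_bound[of _ "?b n"] meas) auto
  have "shifted_value U p f \<delta> lam s \<sigma> i = (\<integral>\<omega>. (\<Sum>n. ?R n (\<omega> n)) \<partial>path_law p \<sigma> i)"
    by (simp add: shifted_value_def stage_reward_def)
  also have "\<dots> = (\<Sum>n. \<integral>\<omega>. ?R n (\<omega> n) \<partial>path_law p \<sigma> i)"
  proof (rule integral_suminf[OF int])
    show "AE \<omega> in path_law p \<sigma> i. summable (\<lambda>n. norm (?R n (\<omega> n)))"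
      using R by (intro AE_I2 summable_comparison_test'[OF summable_b]) auto
    have "(\<integral>\<omega>. \<bar>?R n (\<omega> n)\<bar> \<partial>path_law p \<sigma> i) \<le> ?b n" for n
    proof -
      have "(\<integral>\<omega>. \<bar>?R n (\<omega> n)\<bar> \<partial>path_law p \<sigma> i) \<le> (\<integral>\<omega>. ?b n \<partial>path_law p \<sigma> i)"
        using R int by (intro integral_mono) auto
      then show ?thesis by (simp add: path.prob_space)
    qed
    then show "summable (\<lambda>n. \<integral>\<omega>. norm (?R n (\<omega> n)) \<partial>path_law p \<sigma> i)"
      by (intro summable_comparison_test'[OF summable_b]) auto
  qed
  also have "\<dots> = suminf (a i)"
    by (simp add: expect a_def)
  finally show "shifted_value U p f \<delta> lam s \<sigma> i = suminf (a i)" .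
qed

section \<open>Gibbs controls and equilibria\<close>

abbreviation gain :: "real ^ 's \<Rightarrow> 's \<Rightarrow> real ^ 'l \<Rightarrow> real" where
  "gain y i u \<equiv> f 0 i u + (p u $ i) \<bullet> y"

text \<open>The normalising constant of the Gibbs density. By Gibbs' inequality, \<open>lam\<close>
  times its logarithm is the maximum of expected gain plus \<open>lam\<close> times entropy.\<close>

definition partition_fun :: "real ^ 's \<Rightarrow> 's \<Rightarrow> real" where
  "partition_fun y i = (\<integral>v. exp (1 / lam * gain y i v) \<partial>leb_on U)"

abbreviation "Gdens \<equiv> Gamma_density U p f lam"
abbreviation "Gctrl \<equiv> Gamma_control U p f lam"

lemma Gdens_eq: "Gdens y i u = exp (1 / lam * gain y i u) / partition_fun y i"
  by (simp add: Gamma_density_def partition_fun_def)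

lemma continuous_on_snd_U: "continuous_on U h \<Longrightarrow> continuous_on (K \<times> U) (\<lambda>x. h (snd x))"
  by (rule continuous_on_compose2[where g = h and f = snd]) (auto intro: continuous_intros)

lemma gain_joint_cont: "continuous_on (K \<times> U) (\<lambda>x. gain (fst x) i (snd x))"
  by (intro continuous_intros continuous_on_snd_U f0_cont p_row_cont)

lemma gain_cont: "continuous_on U (gain y i)"
  by (intro continuous_intros f0_cont p_row_cont)

lemma partition_fun_pos: "0 < partition_fun y i"
proof -
  have "integrable (leb_on U) (\<lambda>v. exp (1 / lam * gain y i v))"
    by (intro integrable_leb_on compact_U continuous_intros f0_cont p_row_cont)
  then have "(\<integral>v. 0 \<partial>leb_on U) < partition_fun y i"
    unfolding partition_fun_def by (intro leb.integral_less_AE_space leb_pos) simp_all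
  then show ?thesis by simp
qed

lemma partition_fun_cont:
  assumes "compact K"
  shows "continuous_on K (\<lambda>y. partition_fun y i)"
  unfolding partition_fun_def
proof (rule continuous_on_integral_leb_on[OF compact_U assms])
  show "continuous_on (K \<times> U) (\<lambda>(y, u). exp (1 / lam * gain y i u))"
    unfolding case_prod_beta by (intro continuous_intros gain_joint_cont)
qed

lemma Gdens_joint_cont:
  assumes "compact K"
  shows "continuous_on (K \<times> U) (\<lambda>x. Gdens (fst x) i (snd x))"
proof -
  have "continuous_on (K \<times> U) (\<lambda>x. partition_fun (fst x) i)"
    by (rule continuous_on_compose2[OF partition_fun_cont[OF assms, of i], where f = fst and s = "K \<times> U"])
       (simp_all add: continuous_on_fst image_subset_iff)
  moreover have "continuous_on (K \<times> U) (\<lambda>x. exp (1 / lam * gain (fst x) i (snd x)))"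
    by (intro continuous_intros gain_joint_cont)
  ultimately show ?thesis
    unfolding Gdens_eq
    by (intro continuous_on_divide) (simp_all add: partition_fun_pos less_imp_neq[symmetric])
qed

lemma Gdens_cont: "continuous_on U (Gdens y i)"
proof -
  have "continuous_on U (\<lambda>u. exp (1 / lam * gain y i u))"
    by (intro continuous_intros f0_cont p_row_cont)
  then show ?thesis
    unfolding Gdens_eq using partition_fun_pos[of y i]
    by (intro continuous_on_divide continuous_on_const) simp_all
qed

lemma Gdens_pos: "0 < Gdens y i u"
  unfolding Gdens_eq using partition_fun_pos by simp

lemma ln_Gdens: "ln (Gdens y i u) = gain y i u / lam - ln (partition_fun y i)"
  unfolding Gdens_eq using partition_fun_pos[of y i] less_imp_neq[OF partition_fun_pos[of y i]]
  by (simp add: ln_div)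

lemma Gdens_in_densities: "Gdens y i \<in> densities U"
proof (rule densitiesI)
  show "integrable (leb_on U) (Gdens y i)"
    by (rule integrable_leb_on[OF compact_U Gdens_cont])
  show "0 \<le> Gdens y i u" for u
    using Gdens_pos[of y i u] by simp
  show "(\<integral>u. Gdens y i u \<partial>leb_on U) = 1"
    unfolding Gdens_eq using partition_fun_pos[of y i] by (simp add: partition_fun_def)
qed

lemma dens_entropy_Gdens: "dens_entropy U (Gdens y i) > -\<infinity>"
  unfolding dens_entropy_gt_MInf_iff(1)[OF compact_U Gdens_in_densities]
  by (intro integrable_leb_on compact_U continuous_intros Gdens_cont) (simp add: Gdens_pos less_imp_neq[symmetric])

lemma Gctrl_regular: "Gctrl y \<in> regular_controls U"
  unfolding regular_controls_def relaxed_controls_def Gamma_control_def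
  using Gdens_in_densities dens_entropy_Gdens law_of_in_prob_algebra by blast

lemma Gctrl_relaxed: "Gctrl y \<in> relaxed_controls U"
  using Gctrl_regular by (simp add: regular_controls_def)

lemma entropy_Gctrl: "entropy_of U (Gctrl y i) = - (\<integral>u. ln (Gdens y i u) * Gdens y i u \<partial>leb_on U)"
  unfolding Gamma_control_def
  by (rule entropy_of_law_of[OF compact_U Gdens_in_densities dens_entropy_Gdens])

text \<open>Solving \<open>ln_Gdens\<close> for the gain and integrating against
  \<open>\<rho>\<close> gives the identity: the objective falls short of
  \<open>lam * ln (partition_fun y i)\<close> by \<open>lam\<close> times the relative entropy of
  \<open>\<rho>\<close> with respect to the Gibbs density. Integrability holds because the gain is
  bounded on the compact set \<open>U\<close>.\<close>

lemma one_stage_value: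
  assumes \<rho>: "\<rho> \<in> densities U" "dens_entropy U \<rho> > -\<infinity>"
  shows "(\<integral>u. gain y i u \<partial>law_of U \<rho>) + lam * entropy_of U (law_of U \<rho>)
      = lam * ln (partition_fun y i)
        + lam * ((\<integral>u. ln (Gdens y i u) * \<rho> u \<partial>leb_on U) - (\<integral>u. ln (\<rho> u) * \<rho> u \<partial>leb_on U))"
    and integrable_ln_Gdens_mult: "integrable (leb_on U) (\<lambda>u. ln (Gdens y i u) * \<rho> u)"
proof -
  note D = densitiesD[OF \<rho>(1)]
  have m: "gain y i \<in> borel_measurable (leb_on U)"
    by (rule borel_measurable_integrable[OF integrable_leb_on[OF compact_U gain_cont]])
  obtain B where B: "\<And>u. u \<in> U \<Longrightarrow> \<bar>gain y i u\<bar> \<le> B"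
    using compact_imp_bounded[OF compact_continuous_image[OF gain_cont[where y = y and i = i] compact_U]]
    unfolding bounded_iff by auto
  have int: "integrable (leb_on U) (\<lambda>u. gain y i u * \<rho> u)"
  proof (rule Bochner_Integration.integrable_bound)
    show "integrable (leb_on U) (\<lambda>u. B * \<rho> u)" using D by simp
    show "AE u in leb_on U. norm (gain y i u * \<rho> u) \<le> norm (B * \<rho> u)"
      using B D(2) by (intro AE_I2) (auto simp: space_restrict_space abs_mult intro!: mult_right_mono order_trans[OF _ abs_ge_self])
  qed (use m D in simp)
  have ln_eq: "ln (Gdens y i u) * \<rho> u = (1 / lam) * (gain y i u * \<rho> u) - ln (partition_fun y i) * \<rho> u" for u
    unfolding ln_Gdens by (simp add: algebra_simps add_divide_distrib)
  show "integrable (leb_on U) (\<lambda>u. ln (Gdens y i u) * \<rho> u)"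
    unfolding ln_eq using int D by (intro Bochner_Integration.integrable_diff integrable_mult_right) auto
  have "(\<integral>u. ln (Gdens y i u) * \<rho> u \<partial>leb_on U)
      = (1 / lam) * (\<integral>u. gain y i u * \<rho> u \<partial>leb_on U) - ln (partition_fun y i)"
    unfolding ln_eq using int D by (subst Bochner_Integration.integral_diff) auto
  moreover have "(\<integral>u. gain y i u \<partial>law_of U \<rho>) = (\<integral>u. gain y i u * \<rho> u \<partial>leb_on U)"
    by (simp add: integral_law_of[OF \<rho>(1) m] mult.commute)
  ultimately show "(\<integral>u. gain y i u \<partial>law_of U \<rho>) + lam * entropy_of U (law_of U \<rho>)
      = lam * ln (partition_fun y i)
        + lam * ((\<integral>u. ln (Gdens y i u) * \<rho> u \<partial>leb_on U) - (\<integral>u. ln (\<rho> u) * \<rho> u \<partial>leb_on U))"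
    using lam_pos by (simp add: entropy_of_law_of[OF compact_U \<rho>] right_diff_distrib)
qed

text \<open>The relative entropy in \<open>one_stage_value\<close> is nonnegative and vanishes when
  \<open>\<rho>\<close> is the Gibbs density itself.\<close>

lemma Gctrl_optimal:
  assumes "\<pi> \<in> regular_controls U"
  shows "(\<integral>u. gain y i u \<partial>\<pi> i) + lam * entropy_of U (\<pi> i)
      \<le> (\<integral>u. gain y i u \<partial>Gctrl y i) + lam * entropy_of U (Gctrl y i)"
proof -
  obtain \<rho> where \<rho>: "\<rho> \<in> densities U" "dens_entropy U \<rho> > -\<infinity>" and \<pi>: "\<pi> i = law_of U \<rho>"
    using assms by (auto simp: regular_controls_def)
  note D = densitiesD[OF \<rho>(1)] and G = densitiesD[OF Gdens_in_densities[of y i]]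
  have "(\<integral>u. ln (Gdens y i u) * \<rho> u \<partial>leb_on U) \<le> (\<integral>u. ln (\<rho> u) * \<rho> u \<partial>leb_on U)"
    using D G \<rho> Gdens_pos integrable_ln_Gdens_mult[OF \<rho>] dens_entropy_gt_MInf_iff(1)[OF compact_U \<rho>(1)]
    by (intro entropy_inequality) (auto simp: space_restrict_space)
  then have "lam * ((\<integral>u. ln (Gdens y i u) * \<rho> u \<partial>leb_on U) - (\<integral>u. ln (\<rho> u) * \<rho> u \<partial>leb_on U)) \<le> 0"
    using lam_pos by (intro mult_nonneg_nonpos) auto
  then show ?thesis
    unfolding \<pi> one_stage_value[OF \<rho>] Gamma_control_def
      one_stage_value[OF Gdens_in_densities dens_entropy_Gdens] by simp
qed

text \<open>The first-step equation for a deviation at time \<open>0\<close>. After the first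
  transition the chain follows \<open>\<pi>\<close> while the clock of rewards and discounts reads
  one more, so the continuation value is \<open>V_control\<close> and not \<open>J_policy\<close>:
  for a general discount function the two differ.\<close>

lemma J_policy_concat1:
  assumes \<pi>': "\<pi>' \<in> relaxed_controls U" and \<pi>: "\<pi> \<in> relaxed_controls U"
  shows "J_policy U p f \<delta> lam (concat1 \<pi>' \<pi>) i
      = (\<integral>u. gain (V_control U p f \<delta> lam \<pi>) i u \<partial>\<pi>' i) + lam * entropy_of U (\<pi>' i)"
proof -
  define \<sigma> where "\<sigma> = concat1 \<pi>' \<pi>"
  \<comment> \<open>There are only finitely many states, so summing the absolute entropies of both
    controls bounds all of them at once.\<close>
  define B where "B = (\<Sum>j\<in>UNIV. \<bar>entropy_of U (\<pi>' j)\<bar>) + (\<Sum>j\<in>UNIV. \<bar>entropy_of U (\<pi> j)\<bar>)"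
  have "\<bar>entropy_of U (\<mu> j)\<bar> \<le> (\<Sum>j\<in>UNIV. \<bar>entropy_of U (\<mu> j)\<bar>)" for \<mu> :: "'s \<Rightarrow> _" and j
    by (rule member_le_sum) auto
  moreover have "0 \<le> (\<Sum>j\<in>UNIV. \<bar>entropy_of U (\<mu> j)\<bar>)" for \<mu> :: "'s \<Rightarrow> _"
    by (rule sum_nonneg) simp
  ultimately have B: "\<bar>entropy_of U (\<pi>' j)\<bar> \<le> B" "\<bar>entropy_of U (\<pi> j)\<bar> \<le> B" for j
    unfolding B_def by (meson add_increasing add_increasing2)+
  have \<sigma>: "\<sigma> t \<in> relaxed_controls U" "\<bar>entropy_of U (\<sigma> t j)\<bar> \<le> B" for t j
    using \<pi> \<pi>' B by (auto simp: \<sigma>_def concat1_def)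
  have \<sigma>_simps: "\<sigma> 0 = \<pi>'" "\<sigma> (Suc n) = \<pi>" for n by (simp_all add: \<sigma>_def concat1_def)
  let ?V = "V_control U p f \<delta> lam \<pi>"
  define a where "a n = (\<Sum>k\<in>UNIV. marginal (\<lambda>t. transition p (\<sigma> t)) i n k *
      stage_reward U f \<delta> lam (real (0 + n)) (\<sigma> n) k)" for n
  define b where "b j n = (\<Sum>k\<in>UNIV. marginal (\<lambda>t. transition p \<pi>) j n k *
      stage_reward U f \<delta> lam (real (1 + n)) \<pi> k)" for j n
  have V: "?V $ j = (\<Sum>n. b j n)" "summable (b j)" for j
    using shifted_value_eq_suminf[where \<sigma> = "\<lambda>_. \<pi>" and s = 1, OF \<pi> B(2), of j]
      summable_shifted_value[where \<sigma> = "\<lambda>_. \<pi>" and s = 1, OF \<pi> B(2), of j]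
    by (simp_all add: V_control_def b_def[abs_def])
  have J: "J_policy U p f \<delta> lam \<sigma> i = suminf a" and summable_a: "summable a"
    using shifted_value_eq_suminf[where \<sigma> = \<sigma> and s = 0, OF \<sigma>, of i]
      summable_shifted_value[where \<sigma> = \<sigma> and s = 0, OF \<sigma>, of i]
    by (simp_all add: J_policy_def a_def[abs_def])
  \<comment> \<open>The reward at time \<open>Suc n\<close> of the deviating chain is the reward at
    step \<open>n\<close> of the chain restarted at time \<open>1\<close>, which is the shift
    \<open>1\<close> built into \<open>b\<close>.\<close>
  have a_Suc: "a (Suc n) = (\<Sum>j\<in>UNIV. transition p \<pi>' i j * b j n)" for n
  proof -
    have "a (Suc n) = (\<Sum>k\<in>UNIV. \<Sum>j\<in>UNIV. transition p \<pi>' i j *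
        (marginal (\<lambda>t. transition p \<pi>) j n k * stage_reward U f \<delta> lam (real (1 + n)) \<pi> k))"
      unfolding a_def marginal_first_step \<sigma>_simps by (simp add: sum_distrib_right mult.assoc)
    also have "\<dots> = (\<Sum>j\<in>UNIV. transition p \<pi>' i j * b j n)"
      unfolding b_def sum_distrib_left by (rule sum.swap)
    finally show ?thesis .
  qed
  have a_0: "a 0 = stage_reward U f \<delta> lam 0 \<pi>' i"
    by (simp add: a_def \<sigma>_simps of_bool_def if_distrib[of "\<lambda>x. x * _"] cong: if_cong)
  have "suminf a = a 0 + (\<Sum>n. a (Suc n))"
    using suminf_split_head[OF summable_a] by simp
  also have "(\<Sum>n. a (Suc n)) = (\<Sum>j\<in>UNIV. transition p \<pi>' i j * ?V $ j)"
    unfolding a_Suc V(1) using V(2)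
    by (subst suminf_sum) (auto simp: suminf_mult summable_mult)
  finally have "J_policy U p f \<delta> lam \<sigma> i = stage_reward U f \<delta> lam 0 \<pi>' i + (\<Sum>j\<in>UNIV. transition p \<pi>' i j * ?V $ j)"
    unfolding J a_0 .
  also have "(\<Sum>j\<in>UNIV. transition p \<pi>' i j * ?V $ j) = (\<integral>u. (p u $ i) \<bullet> ?V \<partial>\<pi>' i)"
    and "integrable (\<pi>' i) (\<lambda>u. (p u $ i) \<bullet> ?V)"
  proof -
    have \<mu>: "\<pi>' i \<in> space (prob_algebra (restrict_space borel U))"
      using \<pi>' by (simp add: relaxed_controls_def)
    have int: "integrable (\<pi>' i) (\<lambda>u. p u $ i $ j * ?V $ j)" for j
      using integrable_p[OF \<mu>] by simp
    show "integrable (\<pi>' i) (\<lambda>u. (p u $ i) \<bullet> ?V)"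
      unfolding inner_vec_def using int by simp
    show "(\<Sum>j\<in>UNIV. transition p \<pi>' i j * ?V $ j) = (\<integral>u. (p u $ i) \<bullet> ?V \<partial>\<pi>' i)"
      unfolding inner_vec_def transition_def using int by (simp add: Bochner_Integration.integral_sum)
  qed
  moreover have "integrable (\<pi>' i) (f 0 i)"
    using integrable_f[of "\<pi>' i" 0 i] \<pi>' by (simp add: relaxed_controls_def)
  ultimately show ?thesis
    by (simp add: \<sigma>_def stage_reward_def avg_reward_def \<delta>_0)
qed

text \<open>The stationary policy is its own concatenation, so both sides are given by
  \<open>J_policy_concat1\<close> with the same continuation value. At a fixed point this value is
  \<open>y\<close>, the very vector for which \<open>Gctrl y\<close> is optimal.\<close>

lemma fixed_point_equilibrium:
  assumes "Psi U p f \<delta> lam y = y"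
  shows "regular_equilibrium U p f \<delta> lam (Gctrl y)"
proof -
  have V: "V_control U p f \<delta> lam (Gctrl y) = y"
    using assms by (simp add: Psi_def)
  have "(\<lambda>_. Gctrl y) = concat1 (Gctrl y) (Gctrl y)"
    by (auto simp: concat1_def)
  then have "J_policy U p f \<delta> lam (concat1 \<pi>' (Gctrl y)) i \<le> J_policy U p f \<delta> lam (\<lambda>_. Gctrl y) i"
    if "\<pi>' \<in> regular_controls U" for \<pi>' i
    using that Gctrl_optimal[OF that, where y = y and i = i]
    by (simp add: J_policy_concat1 Gctrl_relaxed regular_controls_def V)
  then show ?thesis
    using Gctrl_regular by (simp add: regular_equilibrium_def)
qed

section \<open>Logarithmic growth of the entropy and the fixed point\<close>

text \<open>The reciprocal of the radius at which the Gibbs density is compared with its neighbours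
  when \<open>norm y \<le> R\<close>. The last summand is a Lipschitz constant of the exponent,
  \<open>1 / r0\<close> keeps the radius within the corkscrew scale, and \<open>1\<close> keeps the
  logarithm nonnegative.\<close>

definition growth :: "real \<Rightarrow> real" where
  "growth R = 1 + 1 / r0 + (L + L * R) / lam"

definition corkscrew_const :: real where
  "corkscrew_const = exp 1 / (unit_ball_vol (real CARD('l)) * \<kappa> ^ CARD('l))"

lemma growth_ge_1: "0 \<le> R \<Longrightarrow> 1 \<le> growth R"
  unfolding growth_def using L_nonneg lam_pos r0_pos by simp

lemma corkscrew_const_pos: "0 < corkscrew_const"
  unfolding corkscrew_const_def using \<kappa>_pos by simp

text \<open>The exponent varies by at most \<open>1\<close> on a ball of radius \<open>1 / growth R\<close>, a fixed
  proportion of which lies in \<open>U\<close> by the corkscrew condition.\<close>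

lemma Gdens_le:
  assumes y: "norm y \<le> R" and u: "u \<in> U"
  shows "Gdens y i u \<le> corkscrew_const * growth R ^ CARD('l)"
proof -
  have R: "0 \<le> R" using y norm_ge_zero order_trans by blast
  have g1: "1 \<le> growth R" by (rule growth_ge_1[OF R])
  define r where "r = 1 / growth R"
  have r: "0 < r" "r \<le> r0" "(L + L * R) * r \<le> lam"
  proof -
    show "0 < r" using g1 by (simp add: r_def)
    have "1 / r0 \<le> growth R" "(L + L * R) / lam \<le> growth R"
      unfolding growth_def using R L_nonneg lam_pos r0_pos by auto
    then show "r \<le> r0" "(L + L * R) * r \<le> lam"
      using g1 r0_pos lam_pos by (auto simp: r_def field_simps)
  qed
  obtain z where z: "ball z (\<kappa> * r) \<subseteq> U \<inter> ball u r"
    using corkscrew u r unfolding corkscrew_condition_def by blast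
  \<comment> \<open>\<open>?E\<close> is the unnormalised Gibbs weight at \<open>u\<close> divided
    by \<open>exp 1\<close>, which bounds the weight from below throughout
    \<open>?B\<close>.\<close>
  let ?B = "ball z (\<kappa> * r)" and ?E = "exp (1 / lam * gain y i u - 1)"
  define vol where "vol = measure lborel ?B"
  have vol: "vol = unit_ball_vol (real CARD('l)) * (\<kappa> * r) ^ CARD('l)"
    unfolding vol_def using r \<kappa>_pos by (subst content_ball) auto
  have vol_pos: "0 < vol" unfolding vol using r \<kappa>_pos by simp
  have E_le: "?E \<le> exp (1 / lam * gain y i v)" if v: "v \<in> ?B" for v
  proof -
    have vU: "v \<in> U" and d: "dist u v \<le> r" using z v by auto
    have "gain y i u - gain y i v = (f 0 i u - f 0 i v) + (p u $ i - p v $ i) \<bullet> y"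
      by (simp add: inner_diff_left)
    also have "\<dots> \<le> L * dist u v + L * dist u v * R"
    proof (intro add_mono)
      show "f 0 i u - f 0 i v \<le> L * dist u v"
        using lipschitz_onD[OF f_lipschitz[of 0 i] u vU] by (simp add: dist_real_def)
      have "(p u $ i - p v $ i) \<bullet> y \<le> norm (p u $ i - p v $ i) * norm y"
        by (rule norm_cauchy_schwarz)
      also have "\<dots> \<le> L * dist u v * R"
        using lipschitz_onD[OF p_lipschitz[of i] u vU] y L_nonneg
        by (intro mult_mono) (auto simp: dist_norm)
      finally show "(p u $ i - p v $ i) \<bullet> y \<le> L * dist u v * R" .
    qed
    also have "\<dots> = (L + L * R) * dist u v" by (simp add: algebra_simps)
    also have "\<dots> \<le> (L + L * R) * r" using d R L_nonneg by (intro mult_left_mono) auto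
    also have "\<dots> \<le> lam" by (rule r(3))
    finally have "1 / lam * (gain y i u - gain y i v) \<le> 1"
      using lam_pos by (simp add: field_simps)
    then show ?thesis by (simp add: right_diff_distrib)
  qed
  have sets_B: "?B \<in> sets (leb_on U)"
    using z by (auto simp: sets_restrict_space_iff borel_compact compact_U)
  \<comment> \<open>Keeping only \<open>?B\<close> in the integral bounds the partition function
    from below by \<open>?E * vol\<close>; in the quotient the weight at \<open>u\<close> cancels
    and \<open>exp 1 / vol\<close> remains.\<close>
  have "?E * vol = (\<integral>v. ?E * indicator ?B v \<partial>leb_on U)"
    using sets_B z sets.sets_into_space[OF sets_B] compact_U
    by (simp add: vol_def measure_restrict_space borel_compact Int_absorb2)
  also have "\<dots> \<le> partition_fun y i"
    unfolding partition_fun_def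
  proof (rule integral_mono)
    show "integrable (leb_on U) (\<lambda>v. ?E * indicator ?B v)"
      using sets_B leb.emeasure_finite by (intro integrable_mult_right integrable_real_indicator) (auto simp: less_top[symmetric])
    show "integrable (leb_on U) (\<lambda>v. exp (1 / lam * gain y i v))"
      by (intro integrable_leb_on compact_U continuous_intros f0_cont p_row_cont)
    show "?E * indicator ?B v \<le> exp (1 / lam * gain y i v)" for v
      using E_le[of v] by (simp split: split_indicator)
  qed
  finally have "Gdens y i u \<le> exp (1 / lam * gain y i u) / (?E * vol)"
    unfolding Gdens_eq using vol_pos partition_fun_pos by (intro divide_left_mono) auto
  also have "\<dots> = exp 1 / vol"
    by (simp add: exp_diff)
  also have "\<dots> = corkscrew_const * growth R ^ CARD('l)"
    using g1 by (simp add: vol r_def corkscrew_const_def power_mult_distrib power_divide)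
  finally show ?thesis .
qed

definition entropy_bound :: "real \<Rightarrow> real" where
  "entropy_bound R = measure (leb_on U) (space (leb_on U)) + \<bar>ln corkscrew_const\<bar>
     + real CARD('l) * ln (growth R)"

text \<open>From above, the entropy is bounded by the volume of \<open>U\<close>, since its
  integrand is at most \<open>1\<close>. From below, the pointwise bound \<open>Gdens_le\<close> is
  integrated against a probability density; taking logarithms turns the power of
  \<open>growth R\<close> into a multiple of \<open>ln (growth R)\<close>.\<close>

lemma abs_entropy_Gctrl_le:
  assumes "norm y \<le> R"
  shows "\<bar>entropy_of U (Gctrl y i)\<bar> \<le> entropy_bound R"
proof -
  have R: "0 \<le> R" using assms norm_ge_zero order_trans by blast
  note D = densitiesD[OF Gdens_in_densities[of y i]]
  let ?I = "\<integral>u. ln (Gdens y i u) * Gdens y i u \<partial>leb_on U"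
  have int: "integrable (leb_on U) (\<lambda>u. ln (Gdens y i u) * Gdens y i u)"
    using dens_entropy_Gdens unfolding dens_entropy_gt_MInf_iff(1)[OF compact_U Gdens_in_densities] .
  have "(\<integral>u. - (ln (Gdens y i u) * Gdens y i u) \<partial>leb_on U) \<le> (\<integral>u. 1 \<partial>leb_on U)"
    using int by (intro integral_mono neg_ln_mult_le_one) (auto simp: less_imp_le[OF Gdens_pos])
  then have upper: "- ?I \<le> measure (leb_on U) (space (leb_on U))"
    using int by simp
  let ?C = "corkscrew_const * growth R ^ CARD('l)"
  have "?I \<le> (\<integral>u. ln ?C * Gdens y i u \<partial>leb_on U)"
  proof (rule integral_mono[OF int])
    fix u assume "u \<in> space (leb_on U)"
    then have "Gdens y i u \<le> ?C" using Gdens_le[OF assms] by (simp add: space_restrict_space)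
    then have "ln (Gdens y i u) \<le> ln ?C" using Gdens_pos[of y i u] by (subst ln_le_cancel_iff) auto
    then show "ln (Gdens y i u) * Gdens y i u \<le> ln ?C * Gdens y i u"
      using Gdens_pos[of y i u] by (intro mult_right_mono) auto
  qed (use D in simp)
  also have "\<dots> = ln ?C" using D by simp
  also have "\<dots> = ln corkscrew_const + real CARD('l) * ln (growth R)"
    using corkscrew_const_pos growth_ge_1[OF R] by (simp add: ln_mult ln_realpow)
  finally have lower: "?I \<le> ln corkscrew_const + real CARD('l) * ln (growth R)" .
  have "0 \<le> real CARD('l) * ln (growth R)" "0 \<le> measure (leb_on U) (space (leb_on U))"
    using growth_ge_1[OF R] by auto
  then show ?thesis
    using upper lower unfolding entropy_Gctrl entropy_bound_def by linarith
qed

definition Psi_term :: "'s \<Rightarrow> nat \<Rightarrow> real ^ 's \<Rightarrow> real" where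
  "Psi_term i n y = (\<Sum>k\<in>UNIV. marginal (\<lambda>_. transition p (Gctrl y)) i n k *
      stage_reward U f \<delta> lam (real (1 + n)) (Gctrl y) k)"

lemma
  assumes "norm y \<le> R"
  shows Psi_term_bound: "\<bar>Psi_term i n y\<bar> \<le> F (1 + n) + lam * \<delta> (real (1 + n)) * entropy_bound R"
    and Psi_eq_suminf: "Psi U p f \<delta> lam y $ i = (\<Sum>n. Psi_term i n y)"
  using shifted_value_term_bound[where \<sigma> = "\<lambda>_. Gctrl y" and s = 1, OF Gctrl_relaxed abs_entropy_Gctrl_le[OF assms]]
    shifted_value_eq_suminf[where \<sigma> = "\<lambda>_. Gctrl y" and s = 1, OF Gctrl_relaxed abs_entropy_Gctrl_le[OF assms]]
  by (simp_all add: Psi_def V_control_def Psi_term_def[abs_def])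

lemma summable_Psi_bound: "summable (\<lambda>n. F (1 + n) + lam * \<delta> (real (1 + n)) * B)"
  using summable_F summable_\<delta> summable_Suc_iff[of F] summable_Suc_iff[of "\<lambda>t. \<delta> (real t)"]
  by (intro summable_add summable_mult2 summable_mult) simp_all

text \<open>Each coordinate is bounded term by term. Passing to the Euclidean norm through the sum
  of absolute coordinates costs the factor \<open>CARD('s)\<close>, harmless since only the growth
  in \<open>R\<close> matters.\<close>

lemma Psi_norm_le:
  assumes "norm y \<le> R"
  shows "norm (Psi U p f \<delta> lam y)
      \<le> real CARD('s) * ((\<Sum>n. F (1 + n)) + lam * (\<Sum>n. \<delta> (real (1 + n))) * entropy_bound R)"
proof -
  have sF: "summable (\<lambda>n. F (1 + n))" and s\<delta>: "summable (\<lambda>n. \<delta> (real (1 + n)))"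
    using summable_F summable_\<delta> summable_Suc_iff[of F] summable_Suc_iff[of "\<lambda>t. \<delta> (real t)"]
    by simp_all
  have "\<bar>Psi U p f \<delta> lam y $ i\<bar> \<le> (\<Sum>n. F (1 + n)) + lam * (\<Sum>n. \<delta> (real (1 + n))) * entropy_bound R" for i
  proof -
    have sb: "summable (\<lambda>n. \<bar>Psi_term i n y\<bar>)"
      using Psi_term_bound[OF assms, of i]
      by (intro summable_comparison_test'[OF summable_Psi_bound[of "entropy_bound R"]]) auto
    have "\<bar>Psi U p f \<delta> lam y $ i\<bar> \<le> (\<Sum>n. \<bar>Psi_term i n y\<bar>)"
      unfolding Psi_eq_suminf[OF assms] by (rule summable_rabs[OF sb])
    also have "\<dots> \<le> (\<Sum>n. F (1 + n) + lam * \<delta> (real (1 + n)) * entropy_bound R)"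
      using Psi_term_bound[OF assms, of i] by (intro suminf_le sb summable_Psi_bound) auto
    also have "\<dots> = (\<Sum>n. F (1 + n)) + (\<Sum>n. lam * \<delta> (real (1 + n)) * entropy_bound R)"
      by (intro suminf_add[symmetric] sF summable_mult2 summable_mult s\<delta>)
    also have "(\<Sum>n. lam * \<delta> (real (1 + n)) * entropy_bound R)
        = lam * (\<Sum>n. \<delta> (real (1 + n))) * entropy_bound R"
      using suminf_mult2[OF summable_mult[OF s\<delta>], of lam "entropy_bound R"] suminf_mult[OF s\<delta>, of lam] by simp
    finally show ?thesis .
  qed
  then have "(\<Sum>i\<in>UNIV. \<bar>Psi U p f \<delta> lam y $ i\<bar>)
      \<le> (\<Sum>i\<in>(UNIV :: 's set). (\<Sum>n. F (1 + n)) + lam * (\<Sum>n. \<delta> (real (1 + n))) * entropy_bound R)"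
    by (intro sum_mono)
  then show ?thesis
    using norm_le_l1_cart[of "Psi U p f \<delta> lam y"] by simp
qed

section \<open>Continuity of \<open>Psi\<close> and Brouwer's theorem\<close>

lemma
  assumes K: "compact K"
  shows avg_reward_Gctrl_cont: "continuous_on K (\<lambda>y. avg_reward f (Gctrl y j) (real t) j)"
    and transition_Gctrl_cont: "continuous_on K (\<lambda>y. transition p (Gctrl y) j k)"
    and entropy_Gctrl_cont: "continuous_on K (\<lambda>y. entropy_of U (Gctrl y j))"
proof -
  have *: "continuous_on K (\<lambda>y. \<integral>u. h u \<partial>Gctrl y j)" if h: "continuous_on U h" for h :: "real ^ 'l \<Rightarrow> real"
  proof -
    have m: "h \<in> borel_measurable (leb_on U)"
      by (rule borel_measurable_integrable[OF integrable_leb_on[OF compact_U h]])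
    show ?thesis
      unfolding Gamma_control_def integral_law_of[OF Gdens_in_densities m]
      by (rule continuous_on_integral_leb_on[OF compact_U K])
         (unfold case_prod_beta, intro continuous_on_mult Gdens_joint_cont[OF K] continuous_on_snd_U h)
  qed
  show "continuous_on K (\<lambda>y. avg_reward f (Gctrl y j) (real t) j)"
    unfolding avg_reward_def by (rule *[OF f_cont])
  show "continuous_on K (\<lambda>y. transition p (Gctrl y) j k)"
    unfolding transition_def by (rule *[OF p_cont])
  have "continuous_on (K \<times> U) (\<lambda>x. ln (Gdens (fst x) j (snd x)))"
    by (intro continuous_on_ln Gdens_joint_cont[OF K]) (simp add: Gdens_pos less_imp_neq[symmetric])
  then show "continuous_on K (\<lambda>y. entropy_of U (Gctrl y j))"
    unfolding entropy_Gctrl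
    by (intro continuous_on_minus continuous_on_integral_leb_on[OF compact_U K])
       (unfold case_prod_beta, intro continuous_on_mult Gdens_joint_cont[OF K])
qed

lemma Psi_term_cont:
  assumes K: "compact K"
  shows "continuous_on K (Psi_term i n)"
proof -
  have "continuous_on K (\<lambda>y. marginal (\<lambda>_. transition p (Gctrl y)) i n k)" for k
    by (induction n arbitrary: k)
       (auto intro!: continuous_on_sum continuous_on_mult continuous_on_const transition_Gctrl_cont[OF K])
  then show ?thesis
    unfolding Psi_term_def[abs_def] stage_reward_def
    by (intro continuous_on_sum continuous_on_mult continuous_on_add continuous_on_const
        avg_reward_Gctrl_cont[OF K] entropy_Gctrl_cont[OF K])
qed

text \<open>On a fixed ball the entropy bound is uniform in \<open>y\<close>, so one summable
  majorant serves all \<open>y\<close> and the series of continuous terms converges uniformly by the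
  Weierstrass test.\<close>

lemma Psi_cont: "continuous_on (cball 0 R) (Psi U p f \<delta> lam)"
proof -
  have "continuous_on (cball 0 R) (\<lambda>y. Psi U p f \<delta> lam y $ i)" for i
  proof -
    have "uniform_limit (cball 0 R) (\<lambda>N y. \<Sum>n<N. Psi_term i n y) (\<lambda>y. \<Sum>n. Psi_term i n y) sequentially"
      using Psi_term_bound
      by (intro Weierstrass_m_test[OF _ summable_Psi_bound[of "entropy_bound R"]]) auto
    then have "continuous_on (cball 0 R) (\<lambda>y. \<Sum>n. Psi_term i n y)"
      by (rule uniform_limit_theorem[rotated])
         (auto intro!: always_eventually continuous_on_sum Psi_term_cont)
    then show ?thesis
      by (rule continuous_on_eq) (simp add: Psi_eq_suminf)
  qed
  then have "continuous_on (cball 0 R) (\<lambda>y. \<chi> i. Psi U p f \<delta> lam y $ i)"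
    by (rule continuous_on_vec_lambda)
  then show ?thesis by simp
qed

lemma Psi_fixed_point: "\<exists>y. Psi U p f \<delta> lam y = y"
proof -
  define SF S\<delta> where "SF = (\<Sum>n. F (1 + n))" and "S\<delta> = (\<Sum>n. \<delta> (real (1 + n)))"
  \<comment> \<open>\<open>a\<close> and \<open>b\<close> are the constant part and the coefficient
    of \<open>ln (growth R)\<close> in the bound of \<open>Psi_norm_le\<close>. As
    \<open>growth R\<close> is affine in \<open>R\<close>, \<open>log_growth_bound\<close> yields a
    ball that \<open>Psi\<close> maps into itself.\<close>
  define b where "b = real CARD('s) * lam * S\<delta> * real CARD('l)"
  define a where "a = real CARD('s) * (SF + lam * S\<delta> * (measure (leb_on U) (space (leb_on U)) + \<bar>ln corkscrew_const\<bar>))"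
  have "0 \<le> SF" "0 \<le> S\<delta>"
    unfolding SF_def S\<delta>_def
    using summable_F summable_\<delta> summable_Suc_iff[of F] summable_Suc_iff[of "\<lambda>t. \<delta> (real t)"] F_nonneg \<delta>_nonneg
    by (auto intro!: suminf_nonneg simp del: of_nat_Suc)
  then have "0 \<le> a" "0 \<le> b"
    using lam_pos by (auto simp: a_def b_def)
  then obtain R where R: "0 \<le> R" "a + b * ln ((1 + 1 / r0 + L / lam) + L / lam * R) \<le> R"
    using log_growth_bound[of a b "1 + 1 / r0 + L / lam" "L / lam"] L_nonneg lam_pos r0_pos
    by (auto simp: add_pos_nonneg)
  have growth: "growth R = (1 + 1 / r0 + L / lam) + L / lam * R"
    by (simp add: growth_def add_divide_distrib)
  have "norm (Psi U p f \<delta> lam y) \<le> R" if "norm y \<le> R" for y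
  proof -
    have "norm (Psi U p f \<delta> lam y) \<le> a + b * ln (growth R)"
      using Psi_norm_le[OF that]
      by (simp add: SF_def S\<delta>_def a_def b_def entropy_bound_def algebra_simps)
    with R growth show ?thesis by simp
  qed
  then have "Psi U p f \<delta> lam \<in> cball 0 R \<rightarrow> cball 0 R" by auto
  with brouwer[OF compact_cball convex_cball _ Psi_cont] R show ?thesis
    by (metis cball_eq_empty not_le)
qed

end

section \<open>From the extended-real hypotheses to the locale\<close>

theorem theorem2p1:
  fixes U :: "(real ^ 'l::{finite,linorder}) set"
    and p :: "real ^ 'l::{finite,linorder} \<Rightarrow> real ^ 's::finite ^ 's"
    and f :: "real \<Rightarrow> 's \<Rightarrow> real ^ 'l::{finite,linorder} \<Rightarrow> real"
    and \<delta> :: "real \<Rightarrow> real"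
  assumes "compact U" and "emeasure lborel U > 0"
    and "\<And>u. u \<in> U \<Longrightarrow> stochastic_matrix (p u)"
    and "\<And>t. 0 \<le> t \<Longrightarrow> \<delta> t \<in> {0..1}" and "antimono_on {0..} \<delta>" and "\<delta> 0 = 1"
    and M_finite: "(\<Sum>t::nat. (SUP (i, u) \<in> UNIV \<times> U. ennreal \<bar>f (real t) i u\<bar>) + ennreal (\<delta> (real t))) < \<infinity>"
    and Theta_finite: "(SUP (t :: nat, i) \<in> UNIV. SUP (u1, u2) \<in> {(u1, u2). u1 \<in> U \<and> u2 \<in> U \<and> u1 \<noteq> u2}.
             ennreal (\<bar>f (real t) i u1 - f (real t) i u2\<bar> / norm (u1 - u2)
                      + norm (p u1 $ i - p u2 $ i) / norm (u1 - u2))) < \<infinity>"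
    and "uniform_cone_condition U"
  shows "\<forall>lam>0. (\<exists>y. Psi U p f \<delta> lam y = y) \<and>
           (\<forall>y. Psi U p f \<delta> lam y = y \<longrightarrow>
              Gamma_control U p f lam y \<in> regular_controls U \<and>
              regular_equilibrium U p f \<delta> lam (Gamma_control U p f lam y))"
proof (intro allI impI)
  fix lam :: real assume "0 < lam"
  define F where "F t = enn2real (SUP (i, u) \<in> UNIV \<times> U. ennreal \<bar>f (real t) i u\<bar>)" for t :: nat
  define L where "L = enn2real (SUP (t :: nat, i) \<in> UNIV. SUP (u1, u2) \<in> {(u1, u2). u1 \<in> U \<and> u2 \<in> U \<and> u1 \<noteq> u2}.
             ennreal (\<bar>f (real t) i u1 - f (real t) i u2\<bar> / norm (u1 - u2)
                      + norm (p u1 $ i - p u2 $ i) / norm (u1 - u2)))"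
  have \<delta>_nonneg: "0 \<le> \<delta> (real t)" for t :: nat
    using assms(4)[of "real t"] by simp
  have M_term: "(SUP (i, u) \<in> UNIV \<times> U. ennreal \<bar>f (real t) i u\<bar>) + ennreal (\<delta> (real t)) < \<infinity>" for t :: nat
    using ennreal_suminf_lessD[OF M_finite, of t] .
  \<comment> \<open>\<open>enn2real\<close> sends infinity to \<open>0\<close>, so
    \<open>F t\<close> is the true supremum only because each term of the finite series is finite;
    the same care is taken for \<open>L\<close> below.\<close>
  have F: "ennreal (F t) = (SUP (i, u) \<in> UNIV \<times> U. ennreal \<bar>f (real t) i u\<bar>)" for t
    unfolding F_def using M_term[of t] by (intro ennreal_enn2real) (auto simp: ennreal_add_less_top)
  have F_nonneg: "0 \<le> F t" for t
    by (simp add: F_def)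
  have "(\<Sum>t. ennreal (F t + \<delta> (real t))) < \<infinity>"
    using M_finite unfolding F[symmetric] by (simp add: F_nonneg \<delta>_nonneg)
  then have sum: "summable (\<lambda>t. F t + \<delta> (real t))"
    by (intro summable_suminf_not_top) (auto simp: F_nonneg \<delta>_nonneg)
  have f_bound: "\<bar>f (real t) i u\<bar> \<le> F t" if "u \<in> U" for t i u
  proof -
    have "ennreal \<bar>f (real t) i u\<bar> \<le> ennreal (F t)"
      unfolding F using that by (intro SUP_upper2[of "(i, u)"]) auto
    then show ?thesis using F_nonneg by simp
  qed
  have L_quot: "\<bar>f (real t) i u1 - f (real t) i u2\<bar> / norm (u1 - u2) + norm (p u1 $ i - p u2 $ i) / norm (u1 - u2) \<le> L"
    if "u1 \<in> U" "u2 \<in> U" "u1 \<noteq> u2" for t :: nat and i u1 u2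
  proof -
    let ?S = "SUP (t :: nat, i) \<in> UNIV. SUP (u1, u2) \<in> {(u1, u2). u1 \<in> U \<and> u2 \<in> U \<and> u1 \<noteq> u2}.
             ennreal (\<bar>f (real t) i u1 - f (real t) i u2\<bar> / norm (u1 - u2)
                      + norm (p u1 $ i - p u2 $ i) / norm (u1 - u2))"
    have "ennreal (\<bar>f (real t) i u1 - f (real t) i u2\<bar> / norm (u1 - u2) + norm (p u1 $ i - p u2 $ i) / norm (u1 - u2)) \<le> ?S"
      using that by (intro SUP_upper2[of "(t, i)"]) (auto intro!: SUP_upper2[of "(u1, u2)"])
    also have "?S = ennreal L"
      unfolding L_def using Theta_finite by (intro ennreal_enn2real[symmetric]) simp
    finally show ?thesis
      by (subst (asm) ennreal_le_iff) (simp_all add: L_def)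
  qed
  \<comment> \<open>Both difference quotients are nonnegative, so a bound on their sum bounds each
    one; the single constant \<open>L\<close> serves rewards and transition rows.\<close>
  have f_lipschitz: "L-lipschitz_on U (f (real t) i)" and p_lipschitz: "L-lipschitz_on U (\<lambda>u. p u $ i)" for t :: nat and i
  proof -
    have "\<bar>f (real t) i u - f (real t) i v\<bar> \<le> L * norm (u - v) \<and> norm (p u $ i - p v $ i) \<le> L * norm (u - v)"
      if "u \<in> U" "v \<in> U" for u v
    proof (cases "u = v")
      case False
      then have pos: "0 < norm (u - v)" by simp
      have "\<bar>f (real t) i u - f (real t) i v\<bar> / norm (u - v) \<le> L" "norm (p u $ i - p v $ i) / norm (u - v) \<le> L"
        using L_quot[OF that False, of t i] by (smt (verit) divide_nonneg_nonneg norm_ge_zero abs_ge_zero)+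
      with pos show ?thesis by (simp add: pos_divide_le_eq)
    qed simp
    then show "L-lipschitz_on U (f (real t) i)" "L-lipschitz_on U (\<lambda>u. p u $ i)"
      by (auto intro!: lipschitz_onI simp: dist_norm L_def)
  qed
  obtain \<kappa> r0 where "0 < \<kappa>" "0 < r0" "corkscrew_condition U \<kappa> r0"
    using uniform_cone_condition_imp_corkscrew assms(9) by blast
  \<comment> \<open>Summability is known for \<open>F t + \<delta> (real t)\<close>; both summands
    are nonnegative, so comparison gives it for each separately.\<close>
  then interpret regularized_control U p f \<delta> lam F L \<kappa> r0
    using assms(1-3,6) \<open>0 < lam\<close> \<delta>_nonneg f_bound f_lipschitz p_lipschitz
      summable_comparison_test'[OF sum, of 0 F] summable_comparison_test'[OF sum, of 0 "\<lambda>t. \<delta> (real t)"]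
    by unfold_locales (auto simp: F_nonneg)
  show "(\<exists>y. Psi U p f \<delta> lam y = y) \<and>
           (\<forall>y. Psi U p f \<delta> lam y = y \<longrightarrow>
              Gamma_control U p f lam y \<in> regular_controls U \<and>
              regular_equilibrium U p f \<delta> lam (Gamma_control U p f lam y))"
    using Psi_fixed_point Gctrl_regular fixed_point_equilibrium by blast
qed

end
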